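(* There exist absolute constants $c>0$ and $C>0$ such that the following holds. Let $n,d\ge 1$ be integers, let $L>0$, and let $X_1,\ldots,X_n\in\mathbb{C}^{d\times d}$ be random matrices sampled i.i.d. from some distribution with $\mathbb{E}[X_i]=\mu$ and $\|X_i\|_{\mathrm{op}}\le L$ almost surely. Set $$f(X_1,\ldots,X_n)=\prod_{i=1}^{n}\left(I+\frac{X_i}{n}\right).$$ Then for every $t$ with $0\le t\le Le^{L}\sqrt{\frac{\log d}{n}}$, $$\Pr\left[\left\|f(X_1,\ldots,X_n)-e^{\mu}\right\|_{\mathrm{op}}\ge t\right]\le 2d\cdot\exp\left(-\frac{c\,n\,t^2}{L^2e^{2L}}\right).$$ Equivalently (as the paper phrases it), for every $\delta\in(0,1)$, with probability greater than $1-\delta$, $$\left\|f(X_1,\ldots,X_n)-e^{\mu}\right\|_{\mathrm{op}}\le \frac{C\,Le^{L}}{\sqrt{n}}\sqrt{\log(d/\delta)}.$$ Both the tail bound and the high-probability bound are asserted.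
   Context: $\|\cdot\|_{\mathrm{op}}$ is the operator (spectral) norm on $\mathbb{C}^{d\times d}$, $I$ is the $d\times d$ identity matrix, $e^{\mu}$ is the matrix exponential of $\mu\in\mathbb{C}^{d\times d}$, and $\log$ is the natural logarithm. The product is ordered: $\prod_{i=1}^{n}A_i=A_1A_2\cdots A_n$. The constants $c$ and $C$ do not depend on $n$, $d$, $L$, $\delta$, $t$ or the distribution of the $X_i$.
   Formalization: The high-probability bound is stated only for d ≥ 2 or δ ≤ 1/2: for d = 1 and δ near 1 it is false (n = L = 1, X₁ = 1 surely gives error e − 2, while √log(1/δ) tends to 0). *)

theory Defs
  imports "HOL-Probability.Probability" "Jordan_Normal_Form.Matrix"
begin

text \<open>
  The dimension is quantified inside the main statement (the constants must not depend on
  it), so matrices come from \<open>Jordan_Normal_Form\<close>, where it is not part of the type.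
\<close>

definition l2_norm :: "complex vec \<Rightarrow> real" where
  "l2_norm v = L2_set (\<lambda>i. cmod (vec_index v i)) {..<dim_vec v}"

definition op_norm :: "complex mat \<Rightarrow> real" where
  "op_norm A = (SUP v \<in> {v \<in> carrier_vec (dim_col A). l2_norm v \<le> 1}. l2_norm (A *\<^sub>v v))"

text \<open>The exponential series, summed entrywise; for square matrices only.\<close>

definition mat_exp :: "complex mat \<Rightarrow> complex mat" where
  "mat_exp A = Matrix.mat (dim_row A) (dim_row A)
     (\<lambda>(i, j). \<Sum>k. (A ^\<^sub>m k) $$ (i, j) / fact k)"

text \<open>
  The Borel \<open>\<sigma>\<close>-algebra of the space of complex \<open>d \<times> d\<close> matrices, generated by the entry
  maps.
\<close>

definition mat_borel :: "nat \<Rightarrow> complex mat measure" where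
  "mat_borel d = sigma (carrier_mat d d)
     {{A \<in> carrier_mat d d. A $$ (i, j) \<in> B} | i j B. i < d \<and> j < d \<and> B \<in> sets borel}"

text \<open>The expectation of a \<open>d \<times> d\<close> random matrix with law \<open>D\<close>, taken entrywise.\<close>

definition mat_expectation :: "nat \<Rightarrow> complex mat measure \<Rightarrow> complex mat" where
  "mat_expectation d D = Matrix.mat d d (\<lambda>(i, j). \<integral>A. A $$ (i, j) \<partial>D)"

text \<open>\<open>A\<^sub>1 * (A\<^sub>2 * (\<dots> * (A\<^sub>n * I)))\<close> for \<open>A\<^sub>i = I + X\<^sub>i / n\<close>, in this order.\<close>

definition perturb_prod :: "nat \<Rightarrow> nat \<Rightarrow> (nat \<Rightarrow> complex mat) \<Rightarrow> complex mat" where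
  "perturb_prod d n X =
     foldr (*) (map (\<lambda>i. 1\<^sub>m d + (1 / of_nat n) \<cdot>\<^sub>m X i) [1..<Suc n]) (1\<^sub>m d)"

text \<open>
  The joint law of \<open>n\<close> i.i.d. random matrices with law \<open>D\<close>. Speaking about this law rather
  than about random variables on a given probability space keeps the type of a sample space
  out of the main statement; otherwise its existentially quantified constants could depend on
  that type. By the lemma below nothing is lost: independent \<open>X\<^sub>1, \<dots>, X\<^sub>n\<close> with common law
  \<open>D\<close>, on any probability space, have this joint law.
\<close>

definition iid_law :: "nat \<Rightarrow> complex mat measure \<Rightarrow> (nat \<Rightarrow> complex mat) measure" where
  "iid_law n D = PiM {1..n} (\<lambda>_. D)"

lemma (in prob_space) distr_iid_eq_iid_law:
  assumes "1 \<le> n"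
    and "indep_vars (\<lambda>_. mat_borel d) X {1..n}"
    and "\<And>i. i \<in> {1..n} \<Longrightarrow> distr M (mat_borel d) (X i) = D"
  shows "distr M (PiM {1..n} (\<lambda>_. mat_borel d)) (\<lambda>\<omega>. \<lambda>i\<in>{1..n}. X i \<omega>) = iid_law n D"
proof -
  have "X i \<in> measurable M (mat_borel d)" if "i \<in> {1..n}" for i
    using assms(2) that by (auto simp: indep_vars_def)
  then have "distr M (PiM {1..n} (\<lambda>_. mat_borel d)) (\<lambda>\<omega>. \<lambda>i\<in>{1..n}. X i \<omega>)
      = PiM {1..n} (\<lambda>i. distr M (mat_borel d) (X i))"
    using assms(1,2) by (subst indep_vars_iff_distr_eq_PiM'[symmetric]) auto
  also have "\<dots> = PiM {1..n} (\<lambda>_. D)"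
    using assms(3) by (intro PiM_cong) auto
  finally show ?thesis by (simp add: iid_law_def)
qed

end

theory Submission
  imports Defs
begin

text \<open>
  The tail bound is vacuous with \<open>c = 1\<close>: in the admissible range of \<open>t\<close> its right-hand side is at
  least \<open>2\<close>. The content is the high-probability bound.

  The Doob martingale of the product has increments of norm at most \<open>\<sigma> = 2 L e\<^sup>L / n\<close>; after a
  Hermitian dilation its even trace moments are controlled without any spectral theory. For
  Hermitian \<open>H(s) = A + s Y\<close> with \<open>\<parallel>Y\<parallel> \<le> \<sigma>\<close>, the function \<open>\<phi>\<^sub>m(s) = tr H(s)\<^bsup>2m\<^esup>\<close> satisfies
  \<open>\<phi>\<^sub>m'' \<le> 2m (2m - 1) \<sigma>\<^sup>2 \<phi>\<^bsub>m-1\<^esub>\<close>, because each \<open>tr (H\<^sup>a Y H\<^sup>b Y)\<close> with \<open>a + b = 2m - 2\<close> is at most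
  \<open>tr (Y\<^sup>2 H\<^bsup>2m-2\<^esup>)\<close>. Integrating twice and averaging over a centred \<open>Y\<close>, the terms linear in \<open>Y\<close>
  vanish and the moments grow no faster than those of a scalar random walk with steps \<open>\<plusminus>\<sigma>\<close>, whence
  a moment bound of order \<open>2d (m n \<sigma>\<^sup>2)\<^sup>m\<close>. Markov's inequality with \<open>m\<close> a power of two comparable to
  \<open>log (d / \<delta>)\<close> gives the deviation from the mean \<open>(I + \<mu> / n)\<^sup>n\<close>, whose distance to \<open>e\<^sup>\<mu>\<close> is at most
  \<open>e\<^sup>L - (1 + L / n)\<^sup>n\<close>. For \<open>L > \<surd>n\<close> the trivial bound \<open>2 e\<^sup>L\<close> suffices.
\<close>

subsection \<open>Traces of words in Hermitian matrices\<close>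

text \<open>The obstacle is noncommutativity: \<open>tr ((H + Y) ^ (2 * m))\<close> has no binomial
  expansion. What survives is that the words \<open>H^a Y H^b Y\<close> in the second derivative are
  all dominated by the one in which the two letters \<open>Y\<close> are adjacent. Such a comparison
  needs self-adjoint matrices, and an even total exponent of \<open>H\<close>. The product is not
  self-adjoint; the dilation repairs this at the price of doubling the dimension, which is the
  origin of the factor \<open>2 d\<close>. The moment bound is an induction on the number of
  factors, for all \<open>m\<close> at once, since one step expresses the moment of order
  \<open>2 m\<close> through all lower even moments of the past. It closes because the claimed bound
  has the form of the even moments of a normal variable, a family stable under adding independent
  steps. Doing without eigenvalues has one visible cost: the operator norm is compared with a trace
  moment by repeated squaring, \<open>norm K ^ 2 <= norm (K * K)\<close>. Hence only exponents
  \<open>m = 2 ^ p\<close> are available, and the choice of \<open>m\<close> is optimal only up to a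
  factor of 2.\<close>

definition adj :: "complex mat \<Rightarrow> complex mat" where
  "adj A = Matrix.mat (dim_col A) (dim_row A) (\<lambda>(i, j). cnj (A $$ (j, i)))"

definition tr :: "complex mat \<Rightarrow> complex" where
  "tr A = (\<Sum>i<dim_row A. A $$ (i, i))"

definition fro2 :: "complex mat \<Rightarrow> real" where
  "fro2 A = (\<Sum>i<dim_row A. \<Sum>j<dim_col A. (cmod (A $$ (i, j)))\<^sup>2)"

text \<open>In the square case the goal determines the inner dimension, so the rule can serve the
  simplifier; in \<open>mult_carrier_mat\<close> that dimension occurs in the premises only.\<close>

lemma mult_carrier_square [simp]:
  "A \<in> carrier_mat n n \<Longrightarrow> B \<in> carrier_mat n n \<Longrightarrow> A * B \<in> carrier_mat n n"
  by (rule mult_carrier_mat)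

lemma adj_carrier [simp]: "A \<in> carrier_mat n m \<Longrightarrow> adj A \<in> carrier_mat m n"
  by (auto simp: adj_def)

lemma adj_index [simp]: "i < dim_col A \<Longrightarrow> j < dim_row A \<Longrightarrow> adj A $$ (i, j) = cnj (A $$ (j, i))"
  by (simp add: adj_def)

lemma adj_dim [simp]: "dim_row (adj A) = dim_col A" "dim_col (adj A) = dim_row A"
  by (simp_all add: adj_def)

lemma mult_index:
  assumes "A \<in> carrier_mat n m" "B \<in> carrier_mat m k" "i < n" "j < k"
  shows "(A * B) $$ (i, j) = (\<Sum>l<m. A $$ (i, l) * B $$ (l, j))"
  using assms by (auto simp: scalar_prod_def lessThan_atLeast0 intro!: sum.cong)

lemma mult_vec_index:
  assumes "A \<in> carrier_mat n m" "v \<in> carrier_vec m" "i < n"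
  shows "vec_index (A *\<^sub>v v) i = (\<Sum>l<m. A $$ (i, l) * vec_index v l)"
  using assms by (auto simp: scalar_prod_def lessThan_atLeast0 intro!: sum.cong)

lemma adj_mult:
  assumes "A \<in> carrier_mat n m" "B \<in> carrier_mat m k"
  shows "adj (A * B) = adj B * adj A"
proof (rule eq_matI)
  fix i j assume "i < dim_row (adj B * adj A)" "j < dim_col (adj B * adj A)"
  then have ij: "i < k" "j < n" using assms by auto
  have "(adj B * adj A) $$ (i, j) = (\<Sum>l<m. adj B $$ (i, l) * adj A $$ (l, j))"
    using assms ij by (intro mult_index) auto
  also have "\<dots> = cnj (\<Sum>l<m. A $$ (j, l) * B $$ (l, i))"
    using assms ij by (auto intro!: sum.cong)
  also have "\<dots> = adj (A * B) $$ (i, j)"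
    using assms ij by (subst adj_index) (auto simp: mult_index[of _ n m _ k] simp del: index_mult_mat(1))
  finally show "adj (A * B) $$ (i, j) = (adj B * adj A) $$ (i, j)" ..
qed (use assms in auto)

lemma pow_mat_add:
  assumes "A \<in> carrier_mat n n"
  shows "A ^\<^sub>m (a + b) = A ^\<^sub>m a * A ^\<^sub>m b"
proof (induction b)
  case 0
  then show ?case using assms by simp
next
  case (Suc b)
  have "A ^\<^sub>m a * A ^\<^sub>m b * A = A ^\<^sub>m a * (A ^\<^sub>m b * A)"
    using assms by (intro assoc_mult_mat) auto
  then show ?case using Suc by simp
qed

lemma pow_mat_Suc_left:
  assumes "A \<in> carrier_mat n n"
  shows "A ^\<^sub>m Suc a = A * A ^\<^sub>m a"
  using pow_mat_add[OF assms, of 1 a] assms by simp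

lemma adj_pow:
  assumes "H \<in> carrier_mat n n" "adj H = H"
  shows "adj (H ^\<^sub>m k) = H ^\<^sub>m k"
proof (induction k)
  case 0
  show ?case using assms(1) by (intro eq_matI) auto
next
  case (Suc k)
  have "adj (H ^\<^sub>m k * H) = H * H ^\<^sub>m k"
    using adj_mult[of "H ^\<^sub>m k" n n H n] assms Suc by simp
  then show ?case using pow_mat_Suc_left[OF assms(1), of k] by simp
qed

lemma tr_mult:
  assumes "A \<in> carrier_mat n m" "B \<in> carrier_mat m n"
  shows "tr (A * B) = (\<Sum>i<n. \<Sum>j<m. A $$ (i, j) * B $$ (j, i))"
  using assms unfolding tr_def
  by (auto simp: mult_index[of _ n m _ n] simp del: index_mult_mat(1) intro!: sum.cong)

lemma tr_comm:
  assumes "A \<in> carrier_mat n m" "B \<in> carrier_mat m n"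
  shows "tr (A * B) = tr (B * A)"
  unfolding tr_mult[OF assms] tr_mult[OF assms(2,1)]
  by (subst sum.swap) (simp add: mult.commute)

lemma fro2_nonneg [simp]: "fro2 A \<ge> 0"
  by (auto simp: fro2_def intro!: sum_nonneg)

lemma tr_mult_adj:
  assumes "A \<in> carrier_mat n m"
  shows "tr (A * adj A) = of_real (fro2 A)"
proof -
  have "tr (A * adj A) = (\<Sum>i<n. \<Sum>j<m. A $$ (i, j) * adj A $$ (j, i))"
    using assms by (intro tr_mult) auto
  also have "\<dots> = (\<Sum>i<n. \<Sum>j<m. of_real ((cmod (A $$ (i, j)))\<^sup>2))"
    using assms by (intro sum.cong refl) (auto simp: complex_norm_square simp del: of_real_power)
  also have "\<dots> = of_real (fro2 A)"
    using assms unfolding fro2_def by auto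
  finally show ?thesis .
qed

lemma fro2_adj [simp]: "fro2 (adj A) = fro2 A"
  unfolding fro2_def by (subst sum.swap) (auto intro!: sum.cong)

lemma tr_adj_amgm:
  assumes "A \<in> carrier_mat n m" "B \<in> carrier_mat n m"
  shows "2 * Re (tr (A * adj B)) \<le> fro2 A + fro2 B"
proof -
  have *: "2 * Re (a * cnj b) \<le> (cmod a)\<^sup>2 + (cmod b)\<^sup>2" for a b
  proof -
    show ?thesis
      using sum_squares_bound[of "Re a" "Re b"] sum_squares_bound[of "Im a" "Im b"]
      by (simp add: cmod_power2)
  qed
  have "tr (A * adj B) = (\<Sum>i<n. \<Sum>j<m. A $$ (i, j) * cnj (B $$ (i, j)))"
    using assms by (subst tr_mult[of _ n m]) (auto intro!: sum.cong)
  then have "2 * Re (tr (A * adj B)) = (\<Sum>i<n. \<Sum>j<m. 2 * Re (A $$ (i, j) * cnj (B $$ (i, j))))"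
    by (simp add: sum_distrib_left)
  also have "\<dots> \<le> (\<Sum>i<n. \<Sum>j<m. (cmod (A $$ (i, j)))\<^sup>2 + (cmod (B $$ (i, j)))\<^sup>2)"
    by (intro sum_mono *)
  also have "\<dots> = fro2 A + fro2 B"
    using assms by (auto simp: fro2_def sum.distrib)
  finally show ?thesis .
qed

text \<open>Discrete maximum principle. At the least index attaining the maximum, an interior
  position has a strictly smaller left neighbour, which contradicts midpoint convexity; so the
  maximum sits at an end, and the two ends agree.\<close>

lemma convex_seq_le_endpoint:
  fixes q :: "nat \<Rightarrow> real"
  assumes conv: "\<And>i. 0 < i \<Longrightarrow> i < r \<Longrightarrow> 2 * q i \<le> q (i - 1) + q (i + 1)"
    and ends: "q r = q 0" and "i \<le> r"
  shows "q i \<le> q 0"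
proof -
  define M where "M = Max (q ` {..r})"
  have le: "q j \<le> M" if "j \<le> r" for j using that by (auto simp: M_def)
  have "M \<in> q ` {..r}" unfolding M_def by (intro Max_in) auto
  then obtain k0 where k0: "k0 \<le> r" "q k0 = M" by auto
  define k where "k = (LEAST j. q j = M)"
  have k: "q k = M" unfolding k_def using k0(2) by (rule LeastI)
  have kk: "k \<le> k0" unfolding k_def using k0(2) by (rule Least_le)
  have min: "q j \<noteq> M" if "j < k" for j using that unfolding k_def by (rule not_less_Least)
  have "q 0 = M"
  proof (rule ccontr)
    assume "q 0 \<noteq> M"
    then have "0 < k" "k \<noteq> r" using k ends by (auto intro: gr0I)
    then have "0 < k" "k < r" using kk k0 by auto
    moreover have "q (k - 1) < M" using min[of "k - 1"] le[of "k - 1"] \<open>0 < k\<close> \<open>k < r\<close> by force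
    moreover have "q (k + 1) \<le> M" using le[of "k + 1"] \<open>k < r\<close> by auto
    ultimately show False using conv[of k] k by linarith
  qed
  then show ?thesis using le \<open>i \<le> r\<close> by simp
qed

text \<open>No spectral theorem is needed: with \<open>q i = fro2 (H ^ i * Y * H ^ (r - i))\<close>, the arithmetic-geometric
  mean inequality bounds the trace at \<open>a = i + j\<close> by \<open>(q i + q j) / 2\<close>, which also makes \<open>q\<close> convex.\<close>

lemma tr_pow_sandwich_le:
  assumes H: "H \<in> carrier_mat n n" "adj H = H" and Y: "Y \<in> carrier_mat n n" "adj Y = Y"
    and ab: "a + b = 2 * r"
  shows "Re (tr (H ^\<^sub>m a * Y * (H ^\<^sub>m b * Y))) \<le> fro2 (Y * H ^\<^sub>m r)"
proof -
  define W where "W i = H ^\<^sub>m i * Y * H ^\<^sub>m (r - i)" for i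
  define q where "q i = fro2 (W i)" for i
  have P: "H ^\<^sub>m i \<in> carrier_mat n n" for i using H by simp
  have Wc: "W i \<in> carrier_mat n n" for i using P Y unfolding W_def by auto
  have adjW: "adj (W i) = H ^\<^sub>m (r - i) * Y * H ^\<^sub>m i" for i
  proof -
    have "adj (W i) = H ^\<^sub>m (r - i) * (Y * H ^\<^sub>m i)"
      unfolding W_def using P Y H
      by (simp add: adj_mult[of _ n n _ n] adj_pow)
    then show ?thesis using P Y by (simp add: assoc_mult_mat[of _ n n _ n _ n])
  qed
  \<comment> \<open>Read the word as the inner product of \<open>W j\<close> and \<open>W i\<close>:
    cyclicity carries the trailing \<open>H ^ i\<close> to the front, and the exponents become
    \<open>i + j\<close> and \<open>(r - j) + (r - i)\<close>.\<close>
  have key: "2 * Re (tr (H ^\<^sub>m c * Y * (H ^\<^sub>m e * Y))) \<le> q i + q j"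
    if "i \<le> r" "j \<le> r" "c = i + j" "c + e = 2 * r" for i j c e
  proof -
    have e: "e = (r - j) + (r - i)" using that by auto
    have "tr (W j * adj (W i)) = tr (H ^\<^sub>m j * Y * H ^\<^sub>m (r - j) * (H ^\<^sub>m (r - i) * Y * H ^\<^sub>m i))"
      by (subst adjW) (simp add: W_def)
    also have "\<dots> = tr ((H ^\<^sub>m j * Y * H ^\<^sub>m (r - j) * H ^\<^sub>m (r - i) * Y) * H ^\<^sub>m i)"
      using P Y by (simp add: assoc_mult_mat[of _ n n _ n _ n])
    also have "\<dots> = tr (H ^\<^sub>m i * (H ^\<^sub>m j * Y * H ^\<^sub>m (r - j) * H ^\<^sub>m (r - i) * Y))"
      using P Y by (intro tr_comm[of _ n n]) auto
    also have "\<dots> = tr ((H ^\<^sub>m i * H ^\<^sub>m j) * Y * ((H ^\<^sub>m (r - j) * H ^\<^sub>m (r - i)) * Y))"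
      using P Y by (simp add: assoc_mult_mat[of _ n n _ n _ n])
    also have "\<dots> = tr (H ^\<^sub>m c * Y * (H ^\<^sub>m e * Y))"
      using that(3) e by (simp add: pow_mat_add[OF H(1)])
    finally show ?thesis using tr_adj_amgm[OF Wc Wc, of j i] by (simp add: q_def)
  qed
  have diag: "Re (tr (H ^\<^sub>m (2 * i) * Y * (H ^\<^sub>m (2 * r - 2 * i) * Y))) = q i" if "i \<le> r" for i
  proof -
    have "tr (W i * adj (W i)) = tr (H ^\<^sub>m i * Y * H ^\<^sub>m (r - i) * (H ^\<^sub>m (r - i) * Y * H ^\<^sub>m i))"
      by (subst adjW) (simp add: W_def)
    also have "\<dots> = tr ((H ^\<^sub>m i * Y * H ^\<^sub>m (r - i) * H ^\<^sub>m (r - i) * Y) * H ^\<^sub>m i)"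
      using P Y by (simp add: assoc_mult_mat[of _ n n _ n _ n])
    also have "\<dots> = tr (H ^\<^sub>m i * (H ^\<^sub>m i * Y * H ^\<^sub>m (r - i) * H ^\<^sub>m (r - i) * Y))"
      using P Y by (intro tr_comm[of _ n n]) auto
    also have "\<dots> = tr ((H ^\<^sub>m i * H ^\<^sub>m i) * Y * ((H ^\<^sub>m (r - i) * H ^\<^sub>m (r - i)) * Y))"
      using P Y by (simp add: assoc_mult_mat[of _ n n _ n _ n])
    also have "\<dots> = tr (H ^\<^sub>m (i + i) * Y * (H ^\<^sub>m ((r - i) + (r - i)) * Y))"
      by (simp only: pow_mat_add[OF H(1)])
    also have "(r - i) + (r - i) = 2 * r - 2 * i" by simp
    finally show ?thesis
      using tr_mult_adj[OF Wc, of i] unfolding q_def mult_2 by (metis Re_complex_of_real)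
  qed
  have "q 0 = fro2 (Y * H ^\<^sub>m r)"
    using H Y by (simp add: q_def W_def)
  moreover have "q r = q 0"
  proof -
    have "W r = adj (W 0)" using adjW[of 0] H Y P by (simp add: W_def)
    then show ?thesis by (simp add: q_def)
  qed
  moreover have qle: "q i \<le> q 0" if "i \<le> r" for i
  proof (rule convex_seq_le_endpoint[OF _ \<open>q r = q 0\<close> that])
    fix i assume i: "0 < i" "i < r"
    \<comment> \<open>The index pair \<open>i - 1\<close>, \<open>i + 1\<close> gives the same word
      as the pair \<open>i\<close>, \<open>i\<close>, and for the latter the trace is exactly
      \<open>q i\<close>.\<close>
    show "2 * q i \<le> q (i - 1) + q (i + 1)"
      using key[of "i - 1" "i + 1" "2 * i" "2 * r - 2 * i"] diag[of i] i by simp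
  qed
  moreover have "\<exists>i j. i \<le> r \<and> j \<le> r \<and> a = i + j"
    using ab by (intro exI[of _ "a div 2"] exI[of _ "a - a div 2"]) auto
  then obtain i j where "i \<le> r" "j \<le> r" "a = i + j" by blast
  ultimately show ?thesis using key[of i j a b] ab qle[of i] qle[of j] by linarith
qed

subsection \<open>A Taylor bound for trace moments\<close>

lemma tr_add:
  assumes "A \<in> carrier_mat n n" "B \<in> carrier_mat n n"
  shows "tr (A + B) = tr A + tr B"
  using assms by (auto simp: tr_def sum.distrib)

text \<open>The derivative of the \<open>k\<close>-th power at \<open>H\<close> in direction
  \<open>Y\<close>: the product rule along the recursion of the matrix power, which appends factors
  on the right.\<close>

fun pow_deriv :: "complex mat \<Rightarrow> complex mat \<Rightarrow> nat \<Rightarrow> complex mat" where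
  "pow_deriv H Y 0 = 0\<^sub>m (dim_row H) (dim_row H)"
| "pow_deriv H Y (Suc k) = pow_deriv H Y k * H + H ^\<^sub>m k * Y"

lemma pow_deriv_carrier [simp]:
  "H \<in> carrier_mat n n \<Longrightarrow> Y \<in> carrier_mat n n \<Longrightarrow> pow_deriv H Y k \<in> carrier_mat n n"
  by (induction k) auto

text \<open>\<open>Z\<close> is arbitrary because each induction step moves the trailing factor
  \<open>H\<close> into it. Later, \<open>Z = 1\<close> gives the first derivative of a trace moment
  and \<open>Z = Y\<close> the second.\<close>

lemma tr_pow_deriv_mult:
  assumes "H \<in> carrier_mat n n" "Y \<in> carrier_mat n n" "Z \<in> carrier_mat n n"
  shows "tr (pow_deriv H Y k * Z) = (\<Sum>a<k. tr (H ^\<^sub>m a * Y * (H ^\<^sub>m (k - Suc a) * Z)))"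
  using assms(3)
proof (induction k arbitrary: Z)
  case 0
  then show ?case using assms by (simp add: tr_def)
next
  case (Suc k)
  have "tr (pow_deriv H Y (Suc k) * Z) = tr (pow_deriv H Y k * (H * Z) + H ^\<^sub>m k * Y * Z)"
    using assms Suc.prems
    by (simp add: add_mult_distrib_mat[of _ n n] assoc_mult_mat[of _ n n _ n _ n])
  also have "\<dots> = (\<Sum>a<k. tr (H ^\<^sub>m a * Y * (H ^\<^sub>m (k - Suc a) * (H * Z)))) + tr (H ^\<^sub>m k * Y * Z)"
    using assms Suc.prems Suc.IH[of "H * Z"] by (simp add: tr_add[of _ n])
  also have "(\<Sum>a<k. tr (H ^\<^sub>m a * Y * (H ^\<^sub>m (k - Suc a) * (H * Z))))
      = (\<Sum>a<k. tr (H ^\<^sub>m a * Y * (H ^\<^sub>m (Suc k - Suc a) * Z)))"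
  proof (intro sum.cong refl)
    fix a assume "a \<in> {..<k}"
    then have *: "Suc k - Suc a = Suc (k - Suc a)" by auto
    have "H ^\<^sub>m (k - Suc a) * (H * Z) = H ^\<^sub>m (Suc k - Suc a) * Z"
      using assms(1) Suc.prems unfolding * by (simp add: assoc_mult_mat[of _ n n _ n _ n])
    then show "tr (H ^\<^sub>m a * Y * (H ^\<^sub>m (k - Suc a) * (H * Z)))
        = tr (H ^\<^sub>m a * Y * (H ^\<^sub>m (Suc k - Suc a) * Z))" by simp
  qed
  finally show ?case using assms Suc.prems by simp
qed

context
  fixes n :: nat and A Y :: "complex mat" and H :: "real \<Rightarrow> complex mat"
  assumes A: "A \<in> carrier_mat n n" and Y: "Y \<in> carrier_mat n n"
  defines "H \<equiv> \<lambda>s. A + complex_of_real s \<cdot>\<^sub>m Y"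
begin

lemma pencil_carrier [simp]: "H s \<in> carrier_mat n n"
  using A Y by (auto simp: H_def)

lemma pow_pencil_deriv:
  assumes "i < n" "j < n"
  shows "((\<lambda>s. (H s ^\<^sub>m k) $$ (i, j)) has_vector_derivative pow_deriv (H s) Y k $$ (i, j)) (at s)"
  using assms
proof (induction k arbitrary: i j)
  case 0
  have "(H s ^\<^sub>m 0) $$ (i, j) = (1\<^sub>m n) $$ (i, j)" for s
    using A Y by (simp add: H_def)
  then show ?case using 0 A Y by (simp add: H_def)
next
  case (Suc k)
  have H': "((\<lambda>s. H s $$ (i, j)) has_vector_derivative Y $$ (i, j)) (at s)" if "i < n" "j < n" for i j
  proof -
    have "H s $$ (i, j) = A $$ (i, j) + of_real s * Y $$ (i, j)" for s
      using A Y that by (simp add: H_def)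
    then show ?thesis by (auto intro!: derivative_eq_intros)
  qed
  have "((\<lambda>s. \<Sum>l<n. (H s ^\<^sub>m k) $$ (i, l) * H s $$ (l, j)) has_vector_derivative
      (\<Sum>l<n. (H s ^\<^sub>m k) $$ (i, l) * Y $$ (l, j) + pow_deriv (H s) Y k $$ (i, l) * H s $$ (l, j))) (at s)"
    using Suc by (intro has_vector_derivative_sum has_vector_derivative_mult H') auto
  also have "(\<lambda>s. \<Sum>l<n. (H s ^\<^sub>m k) $$ (i, l) * H s $$ (l, j)) = (\<lambda>s. (H s ^\<^sub>m Suc k) $$ (i, j))"
    using Suc.prems by (auto simp: mult_index[of _ n n _ n] simp del: index_mult_mat(1))
  also have "(\<Sum>l<n. (H s ^\<^sub>m k) $$ (i, l) * Y $$ (l, j) + pow_deriv (H s) Y k $$ (i, l) * H s $$ (l, j))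
      = pow_deriv (H s) Y (Suc k) $$ (i, j)"
  proof -
    have "pow_deriv (H s) Y (Suc k) $$ (i, j) = (pow_deriv (H s) Y k * H s) $$ (i, j) + (H s ^\<^sub>m k * Y) $$ (i, j)"
      using Suc.prems Y carrier_matD[OF pencil_carrier[of s]] by (simp del: index_mult_mat(1))
    also have "\<dots> = (\<Sum>l<n. pow_deriv (H s) Y k $$ (i, l) * H s $$ (l, j)) + (\<Sum>l<n. (H s ^\<^sub>m k) $$ (i, l) * Y $$ (l, j))"
      using Suc.prems Y by (simp add: mult_index[of _ n n _ n] del: index_mult_mat(1))
    finally show ?thesis by (simp add: sum.distrib)
  qed
  finally show ?case .
qed

lemma tr_pow_pencil_deriv:
  assumes Z: "Z \<in> carrier_mat n n"
  shows "((\<lambda>s. Re (tr (H s ^\<^sub>m k * Z))) has_real_derivative Re (tr (pow_deriv (H s) Y k * Z))) (at s)"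
proof -
  have "((\<lambda>s. \<Sum>i<n. \<Sum>j<n. (H s ^\<^sub>m k) $$ (i, j) * Z $$ (j, i)) has_vector_derivative
      (\<Sum>i<n. \<Sum>j<n. pow_deriv (H s) Y k $$ (i, j) * Z $$ (j, i))) (at s)"
    by (intro has_vector_derivative_sum has_vector_derivative_mult_left pow_pencil_deriv) auto
  then have "((\<lambda>s. tr (H s ^\<^sub>m k * Z)) has_vector_derivative tr (pow_deriv (H s) Y k * Z)) (at s)"
    using Y Z by (simp add: tr_mult[of _ n n])
  then show ?thesis
    unfolding has_real_derivative_iff_has_vector_derivative
    by (rule bounded_linear.has_vector_derivative[OF bounded_linear_Re])
qed

text \<open>By cyclicity all \<open>Suc k\<close> positions of \<open>Y\<close> contribute the same
  trace. The result is again of the form treated by \<open>tr_pow_pencil_deriv\<close>, now with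
  \<open>Z = Y\<close>, so it can be differentiated once more.\<close>

lemma tr_pow_pencil_deriv_one:
  "((\<lambda>s. Re (tr (H s ^\<^sub>m Suc k))) has_real_derivative real (Suc k) * Re (tr (H s ^\<^sub>m k * Y))) (at s)"
proof -
  have "tr (pow_deriv (H s) Y (Suc k) * 1\<^sub>m n) = (\<Sum>a<Suc k. tr (H s ^\<^sub>m k * Y))"
    unfolding tr_pow_deriv_mult[OF pencil_carrier Y one_carrier_mat]
  proof (intro sum.cong refl)
    fix a assume "a \<in> {..<Suc k}"
    then have a: "k = (k - a) + a" by auto
    have "tr (H s ^\<^sub>m a * Y * (H s ^\<^sub>m (Suc k - Suc a) * 1\<^sub>m n)) = tr (H s ^\<^sub>m a * Y * H s ^\<^sub>m (k - a))"
      using right_mult_one_mat[of "H s ^\<^sub>m (k - a)" n n] by simp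
    also have "\<dots> = tr (H s ^\<^sub>m (k - a) * (H s ^\<^sub>m a * Y))"
      using Y by (intro tr_comm[of _ n n]) auto
    also have "\<dots> = tr (H s ^\<^sub>m ((k - a) + a) * Y)"
      using Y by (simp add: pow_mat_add[OF pencil_carrier] assoc_mult_mat[of _ n n _ n _ n])
    finally show "tr (H s ^\<^sub>m a * Y * (H s ^\<^sub>m (Suc k - Suc a) * 1\<^sub>m n)) = tr (H s ^\<^sub>m k * Y)"
      using a by simp
  qed
  then have "Re (tr (pow_deriv (H s) Y (Suc k) * 1\<^sub>m n)) = real (Suc k) * Re (tr (H s ^\<^sub>m k * Y))"
    by (simp add: algebra_simps)
  moreover have "H s ^\<^sub>m Suc k * 1\<^sub>m n = H s ^\<^sub>m Suc k" for s
    by (rule right_mult_one_mat[OF pow_carrier_mat[OF pencil_carrier]])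
  ultimately show ?thesis using tr_pow_pencil_deriv[of "1\<^sub>m n" "Suc k" s] by simp
qed

end

text \<open>Since \<open>Suc k * (Suc N choose Suc k) = Suc N * (N choose k)\<close>,
  differentiation shifts the sequence \<open>c\<close> by one and produces the factor
  \<open>Suc N\<close>. The comparison polynomial thus obeys the same recursion as the trace moments
  it has to dominate.\<close>

lemma binomial_sum_deriv:
  fixes c :: "nat \<Rightarrow> real"
  shows "((\<lambda>s. \<Sum>k\<le>Suc N. real (Suc N choose k) * c k * s ^ k) has_real_derivative
    real (Suc N) * (\<Sum>k\<le>N. real (N choose k) * c (Suc k) * s ^ k)) (at s)"
proof -
  have "((\<lambda>s. \<Sum>k\<le>Suc N. real (Suc N choose k) * c k * s ^ k) has_real_derivative
      (\<Sum>k\<le>Suc N. real (Suc N choose k) * c k * (real k * s ^ (k - 1)))) (at s)"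
    by (intro DERIV_sum) (auto intro!: derivative_eq_intros)
  also have "(\<Sum>k\<le>Suc N. real (Suc N choose k) * c k * (real k * s ^ (k - 1)))
      = (\<Sum>k\<le>N. real (Suc N choose Suc k) * c (Suc k) * (real (Suc k) * s ^ k))"
    by (subst sum.atMost_Suc_shift) simp
  also have "\<dots> = real (Suc N) * (\<Sum>k\<le>N. real (N choose k) * c (Suc k) * s ^ k)"
    unfolding sum_distrib_left
  proof (intro sum.cong refl)
    fix k
    have "real (Suc k) * real (Suc N choose Suc k) = real (Suc N) * real (N choose k)"
      using Suc_times_binomial[of k N] by (metis of_nat_mult)
    then show "real (Suc N choose Suc k) * c (Suc k) * (real (Suc k) * s ^ k)
        = real (Suc N) * (real (N choose k) * c (Suc k) * s ^ k)"
      by (simp add: mult_ac del: of_nat_Suc binomial_Suc_Suc)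
  qed
  finally show ?thesis .
qed

lemma le_of_second_deriv_le:
  fixes f g :: "real \<Rightarrow> real"
  assumes "\<And>s. (f has_real_derivative f' s) (at s)" "\<And>s. (f' has_real_derivative f'' s) (at s)"
    and "\<And>s. (g has_real_derivative g' s) (at s)" "\<And>s. (g' has_real_derivative g'' s) (at s)"
    and le: "\<And>s. 0 \<le> s \<Longrightarrow> f'' s \<le> g'' s" and "f 0 = g 0" "f' 0 = g' 0" and "0 \<le> s"
  shows "f s \<le> g s"
proof -
  have 1: "f' x \<le> g' x" if "0 \<le> x" for x
  proof -
    have "(\<lambda>x. g' x - f' x) 0 \<le> (\<lambda>x. g' x - f' x) x"
      using le by (intro DERIV_nonneg_imp_nondecreasing[OF that])
        (metis DERIV_diff assms(2,4) diff_ge_0_iff_ge)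
    then show ?thesis using assms by simp
  qed
  have "(\<lambda>x. g x - f x) 0 \<le> (\<lambda>x. g x - f x) s"
    using 1 by (intro DERIV_nonneg_imp_nondecreasing[OF \<open>0 \<le> s\<close>])
      (metis DERIV_diff assms(1,3) diff_ge_0_iff_ge)
  then show ?thesis using assms by simp
qed

text \<open>What the coefficients of \<open>tr ((A + s Y) ^ N)\<close> would be, up to binomials, if
  \<open>Y\<close> commuted with \<open>A\<close> and \<open>Y * Y\<close> were
  \<open>sigma^2\<close> times the identity. Odd indices keep one factor \<open>Y\<close>, so that
  averaging over a centred \<open>Y\<close> removes them.\<close>

definition taylor_coeff :: "complex mat \<Rightarrow> complex mat \<Rightarrow> real \<Rightarrow> nat \<Rightarrow> nat \<Rightarrow> real" where
  "taylor_coeff A Y \<sigma> N k = (if even k then \<sigma> ^ k * Re (tr (A ^\<^sub>m (N - k)))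
     else \<sigma> ^ (k - 1) * Re (tr (A ^\<^sub>m (N - k) * Y)))"

text \<open>Up to the terms linear in \<open>Y\<close>, the trace moment grows as if \<open>Y\<close> were a random sign times \<open>\<sigma>\<close>
  commuting with \<open>A\<close>.\<close>

lemma tr_pow_pencil_le:
  assumes A: "A \<in> carrier_mat n n" "adj A = A" and Y: "Y \<in> carrier_mat n n" "adj Y = Y"
    and bound: "\<And>W. W \<in> carrier_mat n n \<Longrightarrow> fro2 (Y * W) \<le> \<sigma>\<^sup>2 * fro2 W"
    and "0 \<le> s"
  shows "Re (tr ((A + complex_of_real s \<cdot>\<^sub>m Y) ^\<^sub>m (2 * m)))
    \<le> (\<Sum>k\<le>2 * m. real (2 * m choose k) * taylor_coeff A Y \<sigma> (2 * m) k * s ^ k)"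
  using \<open>0 \<le> s\<close>
proof (induction m arbitrary: s)
  case 0
  show ?case using A Y by (simp add: taylor_coeff_def tr_def)
next
  case (Suc m)
  define H where "H = (\<lambda>s. A + complex_of_real s \<cdot>\<^sub>m Y)"
  define N where "N = 2 * m"
  define c where "c = taylor_coeff A Y \<sigma> (2 * Suc m)"
  have Hc: "H s \<in> carrier_mat n n" for s using A Y by (auto simp: H_def)
  have Hadj: "adj (H s) = H s" for s
  proof (rule eq_matI)
    fix i j assume "i < dim_row (H s)" "j < dim_col (H s)"
    then have ij: "i < n" "j < n" using Hc[of s] by auto
    have "cnj (A $$ (j, i)) = A $$ (i, j)" "cnj (Y $$ (j, i)) = Y $$ (i, j)"
      using A Y ij by (metis adj_index carrier_matD)+
    then show "adj (H s) $$ (i, j) = H s $$ (i, j)"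
      using ij A Y Hc[of s] by (simp add: H_def)
  qed (use Hc[of s] in auto)
  have H0: "H 0 = A" using A Y by (intro eq_matI) (auto simp: H_def)
  have N2: "2 * Suc m = Suc (Suc N)" by (simp add: N_def)
  have c2: "c (Suc (Suc k)) = \<sigma>\<^sup>2 * taylor_coeff A Y \<sigma> N k" for k
  proof -
    have "2 * Suc m - Suc (Suc k) = N - k" by (simp add: N_def)
    then show ?thesis
      by (cases k) (simp_all add: c_def taylor_coeff_def power2_eq_square mult_ac)
  qed
  \<comment> \<open>Each of the \<open>Suc N\<close> positions of the differentiated factor yields a
    word of degree \<open>N\<close> in \<open>H x\<close>, bounded by
    \<open>sigma^2 tr (H x ^ N)\<close>; the induction hypothesis bounds that trace at the same
    point \<open>x\<close>.\<close>
  have snd: "real (Suc (Suc N)) * Re (tr (pow_deriv (H x) Y (Suc N) * Y))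
      \<le> real (Suc (Suc N)) * (real (Suc N) * (\<Sum>k\<le>N. real (N choose k) * c (Suc (Suc k)) * x ^ k))"
    if "0 \<le> x" for x
  proof -
    have "Re (tr (pow_deriv (H x) Y (Suc N) * Y))
        = (\<Sum>a<Suc N. Re (tr (H x ^\<^sub>m a * Y * (H x ^\<^sub>m (N - a) * Y))))"
      unfolding tr_pow_deriv_mult[OF Hc Y(1) Y(1)] by (simp del: sum.lessThan_Suc)
    also have "\<dots> \<le> (\<Sum>a<Suc N. \<sigma>\<^sup>2 * Re (tr (H x ^\<^sub>m N)))"
    proof (intro sum_mono)
      fix a assume "a \<in> {..<Suc N}"
      then have "Re (tr (H x ^\<^sub>m a * Y * (H x ^\<^sub>m (N - a) * Y))) \<le> fro2 (Y * H x ^\<^sub>m m)"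
        using Y Hc Hadj by (intro tr_pow_sandwich_le[of _ n]) (auto simp: N_def)
      also have "\<dots> \<le> \<sigma>\<^sup>2 * fro2 (H x ^\<^sub>m m)" using Hc by (intro bound) auto
      also have "fro2 (H x ^\<^sub>m m) = Re (tr (H x ^\<^sub>m m * adj (H x ^\<^sub>m m)))"
        using tr_mult_adj[of "H x ^\<^sub>m m" n n] Hc by simp
      also have "H x ^\<^sub>m m * adj (H x ^\<^sub>m m) = H x ^\<^sub>m N"
        using pow_mat_add[OF Hc, of x m m] adj_pow[OF Hc Hadj, of x m] by (simp add: N_def mult_2)
      finally show "Re (tr (H x ^\<^sub>m a * Y * (H x ^\<^sub>m (N - a) * Y))) \<le> \<sigma>\<^sup>2 * Re (tr (H x ^\<^sub>m N))" .
    qed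
    also have "\<dots> = real (Suc N) * (\<sigma>\<^sup>2 * Re (tr (H x ^\<^sub>m N)))" by simp
    also have "\<dots> \<le> real (Suc N) * (\<sigma>\<^sup>2 * (\<Sum>k\<le>N. real (N choose k) * taylor_coeff A Y \<sigma> N k * x ^ k))"
      using Suc.IH[OF that] by (intro mult_left_mono) (auto simp: H_def N_def)
    also have "\<sigma>\<^sup>2 * (\<Sum>k\<le>N. real (N choose k) * taylor_coeff A Y \<sigma> N k * x ^ k)
        = (\<Sum>k\<le>N. real (N choose k) * c (Suc (Suc k)) * x ^ k)"
      by (simp add: c2 sum_distrib_left mult_ac)
    finally show ?thesis by (rule mult_left_mono) simp
  qed
  have "Re (tr (H s ^\<^sub>m Suc (Suc N))) \<le> (\<Sum>k\<le>Suc (Suc N). real (Suc (Suc N) choose k) * c k * s ^ k)"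
  proof (rule le_of_second_deriv_le[where f = "\<lambda>s. Re (tr (H s ^\<^sub>m Suc (Suc N)))"
        and g = "\<lambda>s. \<Sum>k\<le>Suc (Suc N). real (Suc (Suc N) choose k) * c k * s ^ k", OF _ _ _ _ snd])
    show "((\<lambda>s. Re (tr (H s ^\<^sub>m Suc (Suc N)))) has_real_derivative
        real (Suc (Suc N)) * Re (tr (H x ^\<^sub>m Suc N * Y))) (at x)" for x
      unfolding H_def by (rule tr_pow_pencil_deriv_one[OF A(1) Y(1)])
    show "((\<lambda>x. real (Suc (Suc N)) * Re (tr (H x ^\<^sub>m Suc N * Y))) has_real_derivative
        real (Suc (Suc N)) * Re (tr (pow_deriv (H x) Y (Suc N) * Y))) (at x)" for x
      unfolding H_def by (intro DERIV_cmult tr_pow_pencil_deriv[OF A(1) Y(1) Y(1)])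
    show "((\<lambda>s. \<Sum>k\<le>Suc (Suc N). real (Suc (Suc N) choose k) * c k * s ^ k) has_real_derivative
        real (Suc (Suc N)) * (\<Sum>k\<le>Suc N. real (Suc N choose k) * c (Suc k) * x ^ k)) (at x)" for x
      by (rule binomial_sum_deriv)
    show "((\<lambda>x. real (Suc (Suc N)) * (\<Sum>k\<le>Suc N. real (Suc N choose k) * c (Suc k) * x ^ k)) has_real_derivative
        real (Suc (Suc N)) * (real (Suc N) * (\<Sum>k\<le>N. real (N choose k) * c (Suc (Suc k)) * x ^ k))) (at x)" for x
      by (intro DERIV_cmult binomial_sum_deriv)
    \<comment> \<open>As \<open>0 ^ 0 = 1\<close>, the value at 0 is the constant
      coefficient.\<close>
    have z: "(\<Sum>k\<le>M. real (M choose k) * b k * 0 ^ k) = b 0" for M and b :: "nat \<Rightarrow> real"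
      by (subst sum.atMost_shift) simp
    show "Re (tr (H 0 ^\<^sub>m Suc (Suc N))) = (\<Sum>k\<le>Suc (Suc N). real (Suc (Suc N) choose k) * c k * 0 ^ k)"
      unfolding z H0 by (simp add: c_def taylor_coeff_def N_def)
    show "real (Suc (Suc N)) * Re (tr (H 0 ^\<^sub>m Suc N * Y))
        = real (Suc (Suc N)) * (\<Sum>k\<le>Suc N. real (Suc N choose k) * c (Suc k) * 0 ^ k)"
      unfolding z H0 by (simp add: c_def taylor_coeff_def N_def)
    show "0 \<le> s" by fact
  qed
  then show ?case unfolding N2 H_def c_def .
qed

subsection \<open>Operator norm and Hermitian dilation\<close>

lemma l2_norm_sq:
  assumes "v \<in> carrier_vec n"
  shows "(l2_norm v)\<^sup>2 = (\<Sum>i<n. (cmod (vec_index v i))\<^sup>2)"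
  using assms by (auto simp: l2_norm_def L2_set_def intro!: real_sqrt_pow2 sum_nonneg)

lemma l2_norm_nonneg [simp]: "0 \<le> l2_norm v"
  by (simp add: l2_norm_def)

lemma l2_norm_add:
  assumes "v \<in> carrier_vec n" "w \<in> carrier_vec n"
  shows "l2_norm (v + w) \<le> l2_norm v + l2_norm w"
proof -
  have "l2_norm (v + w) \<le> L2_set (\<lambda>i. cmod (vec_index v i) + cmod (vec_index w i)) {..<n}"
    using assms unfolding l2_norm_def by (auto intro!: L2_set_mono norm_triangle_ineq)
  also have "\<dots> \<le> l2_norm v + l2_norm w"
    using assms unfolding l2_norm_def by (auto intro!: L2_set_triangle_ineq)
  finally show ?thesis .
qed

lemma l2_norm_smult: "l2_norm (c \<cdot>\<^sub>v v) = cmod c * l2_norm v"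
  unfolding l2_norm_def
  by (subst L2_set_right_distrib) (auto simp: norm_mult intro!: L2_set_cong)

lemma l2_norm_zero [simp]: "l2_norm (0\<^sub>v n) = 0"
  by (simp add: l2_norm_def L2_set_def)

lemma l2_inner_le:
  assumes "u \<in> carrier_vec n" "v \<in> carrier_vec n"
  shows "cmod (\<Sum>i<n. cnj (vec_index u i) * vec_index v i) \<le> l2_norm u * l2_norm v"
proof -
  have "cmod (\<Sum>i<n. cnj (vec_index u i) * vec_index v i)
      \<le> (\<Sum>i<n. \<bar>cmod (vec_index u i)\<bar> * \<bar>cmod (vec_index v i)\<bar>)"
    by (rule order_trans[OF norm_sum]) (simp add: norm_mult)
  also have "\<dots> \<le> l2_norm u * l2_norm v"
    using assms L2_set_mult_ineq[of "\<lambda>i. cmod (vec_index u i)" "\<lambda>i. cmod (vec_index v i)" "{..<n}"]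
    by (simp add: l2_norm_def)
  finally show ?thesis .
qed

lemma l2_inner_adj:
  assumes "A \<in> carrier_mat n m" "u \<in> carrier_vec m" "v \<in> carrier_vec n"
  shows "(\<Sum>i<n. cnj (vec_index (A *\<^sub>v u) i) * vec_index v i)
    = (\<Sum>j<m. cnj (vec_index u j) * vec_index (adj A *\<^sub>v v) j)"
proof -
  have "(\<Sum>i<n. cnj (vec_index (A *\<^sub>v u) i) * vec_index v i)
      = (\<Sum>i<n. \<Sum>j<m. cnj (A $$ (i, j)) * cnj (vec_index u j) * vec_index v i)"
    by (intro sum.cong refl)
      (simp add: mult_vec_index[OF assms(1,2)] sum_distrib_right del: index_mult_mat_vec)
  also have "\<dots> = (\<Sum>j<m. \<Sum>i<n. cnj (A $$ (i, j)) * cnj (vec_index u j) * vec_index v i)"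
    by (rule sum.swap)
  also have "\<dots> = (\<Sum>j<m. cnj (vec_index u j) * vec_index (adj A *\<^sub>v v) j)"
    using assms(1)
    by (intro sum.cong refl)
      (auto simp: mult_vec_index[OF adj_carrier[OF assms(1)] assms(3)] sum_distrib_left mult_ac
        simp del: index_mult_mat_vec intro!: sum.cong)
  finally show ?thesis .
qed

lemma l2_norm_sq_inner:
  assumes "v \<in> carrier_vec n"
  shows "of_real ((l2_norm v)\<^sup>2) = (\<Sum>i<n. cnj (vec_index v i) * vec_index v i)"
  unfolding l2_norm_sq[OF assms] of_real_sum
  by (intro sum.cong refl) (metis complex_norm_square mult.commute)

text \<open>\<open>r\<close> is any admissible bound, not the least one, so bounds on sums, products
  and limits combine without suprema. For \<open>0 <= r\<close> this agrees with
  \<open>op_norm A <= r\<close> by \<open>op_norm_le_iff\<close>.\<close>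

definition mat_bound :: "nat \<Rightarrow> complex mat \<Rightarrow> real \<Rightarrow> bool" where
  "mat_bound n A r \<longleftrightarrow> A \<in> carrier_mat n n \<and> (\<forall>v\<in>carrier_vec n. l2_norm (A *\<^sub>v v) \<le> r * l2_norm v)"

lemma mat_bound_carrier [dest]: "mat_bound n A r \<Longrightarrow> A \<in> carrier_mat n n"
  by (simp add: mat_bound_def)

lemma mat_boundD: "mat_bound n A r \<Longrightarrow> v \<in> carrier_vec n \<Longrightarrow> l2_norm (A *\<^sub>v v) \<le> r * l2_norm v"
  by (simp add: mat_bound_def)

lemma mat_bound_mono: "mat_bound n A r \<Longrightarrow> r \<le> s \<Longrightarrow> mat_bound n A s"
  unfolding mat_bound_def by (meson l2_norm_nonneg mult_right_mono order_trans)

lemma fro2_cols: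
  assumes "A \<in> carrier_mat n m"
  shows "fro2 A = (\<Sum>j<m. (l2_norm (col A j))\<^sup>2)"
proof -
  have "fro2 A = (\<Sum>j<m. \<Sum>i<n. (cmod (A $$ (i, j)))\<^sup>2)"
    using assms unfolding fro2_def by (subst sum.swap) auto
  also have "\<dots> = (\<Sum>j<m. (l2_norm (col A j))\<^sup>2)"
    using assms by (intro sum.cong refl) (auto simp: l2_norm_sq[of _ n])
  finally show ?thesis .
qed

text \<open>Cauchy-Schwarz in each row, with \<open>w i\<close> the conjugated row. This makes the
  supremum in \<open>op_norm\<close> finite, and it is also the final passage from the operator norm
  to a trace.\<close>

lemma mat_bound_fro2:
  assumes "A \<in> carrier_mat n n"
  shows "mat_bound n A (sqrt (fro2 A))"
  unfolding mat_bound_def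
proof (intro conjI ballI assms)
  fix v :: "complex vec" assume v: "v \<in> carrier_vec n"
  define w where "w i = Matrix.vec n (\<lambda>j. cnj (A $$ (i, j)))" for i
  have w: "w i \<in> carrier_vec n" for i by (simp add: w_def)
  have nw: "(l2_norm (w i))\<^sup>2 = (\<Sum>j<n. (cmod (A $$ (i, j)))\<^sup>2)" for i
    using l2_norm_sq[OF w, of i] by (simp add: w_def)
  have "(l2_norm (A *\<^sub>v v))\<^sup>2 = (\<Sum>i<n. (cmod (vec_index (A *\<^sub>v v) i))\<^sup>2)"
    using assms v by (intro l2_norm_sq mult_mat_vec_carrier[of _ _ n])
  also have "\<dots> \<le> (\<Sum>i<n. (l2_norm (w i) * l2_norm v)\<^sup>2)"
  proof (intro sum_mono power_mono)
    fix i assume "i \<in> {..<n}"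
    then have "vec_index (A *\<^sub>v v) i = (\<Sum>j<n. cnj (vec_index (w i) j) * vec_index v j)"
      using assms v by (simp add: mult_vec_index[of _ n n] w_def del: index_mult_mat_vec)
    then show "cmod (vec_index (A *\<^sub>v v) i) \<le> l2_norm (w i) * l2_norm v"
      using l2_inner_le[OF w v] by metis
  qed simp
  also have "\<dots> = fro2 A * (l2_norm v)\<^sup>2"
    using assms by (simp add: power_mult_distrib nw fro2_def flip: sum_distrib_right)
  finally have "l2_norm (A *\<^sub>v v) \<le> sqrt (fro2 A * (l2_norm v)\<^sup>2)"
    by (rule real_le_rsqrt)
  then show "l2_norm (A *\<^sub>v v) \<le> sqrt (fro2 A) * l2_norm v"
    by (simp add: real_sqrt_mult)
qed

section \<open>The operator norm as the least bound\<close>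

lemma op_norm_bdd_above:
  assumes "A \<in> carrier_mat n n"
  shows "bdd_above ((\<lambda>v. l2_norm (A *\<^sub>v v)) ` {v \<in> carrier_vec (dim_col A). l2_norm v \<le> 1})"
proof (rule bdd_aboveI2)
  fix v assume v: "v \<in> {v \<in> carrier_vec (dim_col A). l2_norm v \<le> 1}"
  then have "l2_norm (A *\<^sub>v v) \<le> sqrt (fro2 A) * l2_norm v"
    using assms by (intro mat_boundD[OF mat_bound_fro2]) auto
  also have "\<dots> \<le> sqrt (fro2 A) * 1" using v by (intro mult_left_mono) auto
  finally show "l2_norm (A *\<^sub>v v) \<le> sqrt (fro2 A) * 1" .
qed

lemma op_norm_nonneg:
  assumes "A \<in> carrier_mat n n"
  shows "0 \<le> op_norm A"
proof -
  have "l2_norm (A *\<^sub>v 0\<^sub>v n) \<le> op_norm A"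
    unfolding op_norm_def using assms by (intro cSUP_upper op_norm_bdd_above) auto
  then show ?thesis using l2_norm_nonneg order_trans by blast
qed

lemma mat_bound_op_norm:
  assumes "A \<in> carrier_mat n n"
  shows "mat_bound n A (op_norm A)"
  unfolding mat_bound_def
proof (intro conjI ballI assms)
  fix v :: "complex vec" assume v: "v \<in> carrier_vec n"
  show "l2_norm (A *\<^sub>v v) \<le> op_norm A * l2_norm v"
  proof (cases "l2_norm v = 0")
    case True
    then show ?thesis using mat_boundD[OF mat_bound_fro2[OF assms] v] by simp
  next
    case False
    then have pos: "l2_norm v > 0" using l2_norm_nonneg[of v] by linarith
    define c where "c = complex_of_real (1 / l2_norm v)"
    have "l2_norm (c \<cdot>\<^sub>v v) \<le> 1" using pos by (simp add: l2_norm_smult c_def norm_divide)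
    then have "l2_norm (A *\<^sub>v (c \<cdot>\<^sub>v v)) \<le> op_norm A"
      unfolding op_norm_def using assms v by (intro cSUP_upper op_norm_bdd_above) auto
    also have "A *\<^sub>v (c \<cdot>\<^sub>v v) = c \<cdot>\<^sub>v (A *\<^sub>v v)" using assms v by (rule mult_mat_vec)
    finally have "(1 / l2_norm v) * l2_norm (A *\<^sub>v v) \<le> op_norm A"
      using pos by (simp add: l2_norm_smult c_def norm_divide)
    then show ?thesis using pos by (simp add: divide_simps)
  qed
qed

lemma op_norm_le:
  assumes "mat_bound n A r" "0 \<le> r"
  shows "op_norm A \<le> r"
  unfolding op_norm_def
proof (rule cSUP_least)
  have "0\<^sub>v (dim_col A) \<in> {v \<in> carrier_vec (dim_col A). l2_norm v \<le> 1}" by simp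
  then show "{v \<in> carrier_vec (dim_col A). l2_norm v \<le> 1} \<noteq> {}" by blast
next
  fix v assume v: "v \<in> {v \<in> carrier_vec (dim_col A). l2_norm v \<le> 1}"
  then have "l2_norm (A *\<^sub>v v) \<le> r * l2_norm v"
    using assms by (intro mat_boundD[of n]) auto
  also have "\<dots> \<le> r * 1" using v assms(2) by (intro mult_left_mono) auto
  finally show "l2_norm (A *\<^sub>v v) \<le> r" by simp
qed

lemma op_norm_le_iff:
  assumes "A \<in> carrier_mat n n" "0 \<le> r"
  shows "op_norm A \<le> r \<longleftrightarrow> mat_bound n A r"
  using op_norm_le[OF _ assms(2)] mat_bound_mono[OF mat_bound_op_norm[OF assms(1)]] by blast

section \<open>Arithmetic of operator norm bounds\<close>

lemma mat_bound_add:
  assumes "mat_bound n A r" "mat_bound n B s"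
  shows "mat_bound n (A + B) (r + s)"
  unfolding mat_bound_def
proof (intro conjI ballI)
  note AB = mat_bound_carrier[OF assms(1)] mat_bound_carrier[OF assms(2)]
  show "A + B \<in> carrier_mat n n" using AB by auto
  fix v :: "complex vec" assume v: "v \<in> carrier_vec n"
  have "l2_norm ((A + B) *\<^sub>v v) = l2_norm (A *\<^sub>v v + B *\<^sub>v v)"
    using AB v by (simp add: add_mult_distrib_mat_vec[of _ n n])
  also have "\<dots> \<le> l2_norm (A *\<^sub>v v) + l2_norm (B *\<^sub>v v)"
    using AB v by (intro l2_norm_add[of _ n]) auto
  also have "\<dots> \<le> r * l2_norm v + s * l2_norm v"
    using assms v by (intro add_mono mat_boundD) auto
  finally show "l2_norm ((A + B) *\<^sub>v v) \<le> (r + s) * l2_norm v" by (simp add: algebra_simps)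
qed

lemma smult_mat_vec:
  assumes "A \<in> carrier_mat n m" "v \<in> carrier_vec m"
  shows "(c \<cdot>\<^sub>m A) *\<^sub>v v = c \<cdot>\<^sub>v (A *\<^sub>v (v :: complex vec))"
  using assms
  by (intro eq_vecI)
    (auto simp: mult_vec_index[of _ n m] sum_distrib_left mult_ac simp del: index_mult_mat_vec)

lemma mat_bound_smult:
  assumes "mat_bound n A r"
  shows "mat_bound n (c \<cdot>\<^sub>m A) (cmod c * r)"
proof -
  have A: "A \<in> carrier_mat n n" using assms by auto
  have "l2_norm ((c \<cdot>\<^sub>m A) *\<^sub>v v) \<le> cmod c * r * l2_norm v" if "v \<in> carrier_vec n" for v
    using mat_boundD[OF assms that]
    by (simp add: smult_mat_vec[OF A that] l2_norm_smult mult_left_mono mult.assoc)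
  then show ?thesis using A by (auto simp: mat_bound_def)
qed

lemma mat_bound_minus:
  assumes "mat_bound n A r" "mat_bound n B s"
  shows "mat_bound n (A - B) (r + s)"
proof -
  have "A - B = A + (-1) \<cdot>\<^sub>m B" by (intro eq_matI) auto
  then show ?thesis using mat_bound_add[OF assms(1) mat_bound_smult[OF assms(2), of "-1"]] by simp
qed

lemma mat_bound_mult:
  assumes "mat_bound n A r" "mat_bound n B s" "0 \<le> r"
  shows "mat_bound n (A * B) (r * s)"
  unfolding mat_bound_def
proof (intro conjI ballI)
  note AB = mat_bound_carrier[OF assms(1)] mat_bound_carrier[OF assms(2)]
  show "A * B \<in> carrier_mat n n" using AB by auto
  fix v :: "complex vec" assume v: "v \<in> carrier_vec n"
  have "l2_norm (A * B *\<^sub>v v) = l2_norm (A *\<^sub>v (B *\<^sub>v v))" using AB v by simp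
  also have "\<dots> \<le> r * l2_norm (B *\<^sub>v v)"
    using AB v by (intro mat_boundD[OF assms(1)]) auto
  also have "\<dots> \<le> r * (s * l2_norm v)"
    using v assms by (intro mult_left_mono mat_boundD) auto
  finally show "l2_norm (A * B *\<^sub>v v) \<le> r * s * l2_norm v" by (simp add: mult.assoc)
qed

lemma mat_bound_one: "mat_bound n (1\<^sub>m n) 1"
  by (auto simp: mat_bound_def)

lemma mat_bound_pow:
  assumes "mat_bound n A r" "0 \<le> r"
  shows "mat_bound n (A ^\<^sub>m k) (r ^ k)"
proof (induction k)
  case 0
  show ?case using assms mat_bound_one by (auto dest!: mat_bound_carrier)
next
  case (Suc k)
  then show ?case using mat_bound_mult[OF Suc assms(1)] assms(2) by (simp add: mult.commute)
qed

text \<open>For \<open>w = adj A v\<close>, moving the adjoint across the inner product gives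
  \<open>norm w ^ 2 = <A w, v> <= r * norm w * norm v\<close>; then cancel
  \<open>norm w\<close>.\<close>

lemma mat_bound_adj:
  assumes "mat_bound n A r" "0 \<le> r"
  shows "mat_bound n (adj A) r"
  unfolding mat_bound_def
proof (intro conjI ballI)
  have A: "A \<in> carrier_mat n n" using assms by auto
  show aA: "adj A \<in> carrier_mat n n" using A by simp
  fix v :: "complex vec" assume v: "v \<in> carrier_vec n"
  define w where "w = adj A *\<^sub>v v"
  have w: "w \<in> carrier_vec n" using aA v by (simp add: w_def)
  have "complex_of_real ((l2_norm w)\<^sup>2) = (\<Sum>i<n. cnj (vec_index w i) * vec_index w i)"
    by (rule l2_norm_sq_inner[OF w])
  also have "\<dots> = (\<Sum>i<n. cnj (vec_index (A *\<^sub>v w) i) * vec_index v i)"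
    using l2_inner_adj[OF A w v] by (simp add: w_def)
  finally have "(l2_norm w)\<^sup>2 \<le> l2_norm (A *\<^sub>v w) * l2_norm v"
    using l2_inner_le[of "A *\<^sub>v w" n v] A v w
    by (metis abs_of_nonneg mult_mat_vec_carrier norm_of_real zero_le_power2)
  also have "\<dots> \<le> r * l2_norm w * l2_norm v"
    by (intro mult_right_mono mat_boundD[OF assms(1) w]) simp
  finally have "l2_norm w * l2_norm w \<le> (r * l2_norm v) * l2_norm w"
    by (simp add: power2_eq_square mult_ac)
  then show "l2_norm (adj A *\<^sub>v v) \<le> r * l2_norm v"
    using assms(2) l2_norm_nonneg[of w] unfolding w_def[symmetric]
    by (cases "l2_norm w = 0") auto
qed

text \<open>The operator norm bound applies to each column of \<open>W\<close>. This discharges the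
  hypothesis \<open>bound\<close> of \<open>tr_pow_pencil_le\<close>.\<close>

lemma fro2_mult_le:
  assumes "mat_bound n A r" "0 \<le> r" "W \<in> carrier_mat n m"
  shows "fro2 (A * W) \<le> r\<^sup>2 * fro2 W"
proof -
  have A: "A \<in> carrier_mat n n" using assms by auto
  have "fro2 (A * W) = (\<Sum>j<m. (l2_norm (col (A * W) j))\<^sup>2)"
    using A assms(3) by (intro fro2_cols) auto
  also have "\<dots> \<le> (\<Sum>j<m. (r * l2_norm (col W j))\<^sup>2)"
    using A assms by (intro sum_mono power_mono) (auto simp: col_mult2[OF A assms(3)] intro!: mat_boundD)
  also have "\<dots> = r\<^sup>2 * fro2 W"
    by (simp add: fro2_cols[OF assms(3)] power_mult_distrib sum_distrib_left)
  finally show ?thesis .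
qed

text \<open>A substitute for the largest eigenvalue. For self-adjoint \<open>K\<close> one has
  \<open>norm (K v) ^ 2 = <v, K K v>\<close>, hence \<open>norm K ^ 2 <= norm (K * K)\<close>;
  iterating this doubles the exponent each time, which is why it is a power of two.\<close>

lemma op_norm_pow_le_fro2:
  assumes "H \<in> carrier_mat n n" "adj H = H"
  shows "(op_norm H ^ 2 ^ p)\<^sup>2 \<le> fro2 (H ^\<^sub>m (2 ^ p))"
proof -
  have sq: "(op_norm K)\<^sup>2 \<le> op_norm (K * K)" if K: "K \<in> carrier_mat n n" "adj K = K" for K
  proof -
    have KK: "K * K \<in> carrier_mat n n" using K by simp
    have "mat_bound n K (sqrt (op_norm (K * K)))"
      unfolding mat_bound_def
    proof (intro conjI ballI K)
      fix v :: "complex vec" assume v: "v \<in> carrier_vec n"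
      have Kv: "K *\<^sub>v v \<in> carrier_vec n" using K v by auto
      have "complex_of_real ((l2_norm (K *\<^sub>v v))\<^sup>2) = (\<Sum>j<n. cnj (vec_index v j) * vec_index (K * K *\<^sub>v v) j)"
        using l2_norm_sq_inner[OF Kv] l2_inner_adj[OF K(1) v Kv] K v by simp
      then have "(l2_norm (K *\<^sub>v v))\<^sup>2 \<le> l2_norm v * l2_norm (K * K *\<^sub>v v)"
        using l2_inner_le[of v n "K * K *\<^sub>v v"] v KK
        by (metis abs_of_nonneg mult_mat_vec_carrier norm_of_real zero_le_power2)
      also have "\<dots> \<le> l2_norm v * (op_norm (K * K) * l2_norm v)"
        by (intro mult_left_mono mat_boundD[OF mat_bound_op_norm[OF KK] v]) simp
      also have "\<dots> = op_norm (K * K) * (l2_norm v)\<^sup>2" by (simp add: power2_eq_square)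
      finally have "l2_norm (K *\<^sub>v v) \<le> sqrt (op_norm (K * K) * (l2_norm v)\<^sup>2)" by (rule real_le_rsqrt)
      then show "l2_norm (K *\<^sub>v v) \<le> sqrt (op_norm (K * K)) * l2_norm v"
        by (simp add: real_sqrt_mult)
    qed
    then have "op_norm K \<le> sqrt (op_norm (K * K))"
      using op_norm_nonneg[OF KK] by (intro op_norm_le) auto
    then have "(op_norm K)\<^sup>2 \<le> (sqrt (op_norm (K * K)))\<^sup>2"
      using op_norm_nonneg[OF K(1)] by (intro power_mono)
    then show ?thesis using op_norm_nonneg[OF KK] by simp
  qed
  have Pc: "H ^\<^sub>m k \<in> carrier_mat n n" for k using assms by simp
  have "op_norm H ^ 2 ^ p \<le> op_norm (H ^\<^sub>m (2 ^ p))"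
  proof (induction p)
    case 0
    show ?case using assms by simp
  next
    case (Suc p)
    have "op_norm H ^ 2 ^ Suc p = (op_norm H ^ 2 ^ p)\<^sup>2"
      by (simp add: power_mult[symmetric] mult.commute)
    also have "\<dots> \<le> (op_norm (H ^\<^sub>m (2 ^ p)))\<^sup>2"
      using Suc op_norm_nonneg[OF assms(1)] by (intro power_mono) auto
    also have "\<dots> \<le> op_norm (H ^\<^sub>m (2 ^ p) * H ^\<^sub>m (2 ^ p))"
      using assms by (intro sq Pc adj_pow)
    also have "H ^\<^sub>m (2 ^ p) * H ^\<^sub>m (2 ^ p) = H ^\<^sub>m (2 ^ Suc p)"
      using pow_mat_add[OF assms(1), of "2 ^ p" "2 ^ p"] by (simp add: mult_2)
    finally show ?case .
  qed
  also have "\<dots> \<le> sqrt (fro2 (H ^\<^sub>m (2 ^ p)))"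
    by (intro op_norm_le[of n] mat_bound_fro2 Pc) simp
  finally have "(op_norm H ^ 2 ^ p)\<^sup>2 \<le> (sqrt (fro2 (H ^\<^sub>m (2 ^ p))))\<^sup>2"
    using op_norm_nonneg[OF assms(1)] by (intro power_mono) auto
  then show ?thesis by simp
qed

text \<open>The block matrix with zero diagonal blocks, \<open>Z\<close> in the upper right and
  \<open>adj Z\<close> in the lower left. It is self-adjoint for every \<open>Z\<close> and additive
  in \<open>Z\<close>, so it carries martingale increments to self-adjoint increments, and it
  preserves operator norm bounds.\<close>

definition dilation :: "nat \<Rightarrow> complex mat \<Rightarrow> complex mat" where
  "dilation d Z = Matrix.mat (d + d) (d + d) (\<lambda>(i, j).
     if i < d \<and> d \<le> j then Z $$ (i, j - d) else if d \<le> i \<and> j < d then cnj (Z $$ (j, i - d)) else 0)"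

lemma dilation_carrier [simp]: "dilation d Z \<in> carrier_mat (d + d) (d + d)"
  by (simp add: dilation_def)

lemma adj_dilation [simp]: "adj (dilation d Z) = dilation d Z"
  by (rule eq_matI) (auto simp: dilation_def)

lemma dilation_add:
  assumes "A \<in> carrier_mat d d" "B \<in> carrier_mat d d"
  shows "dilation d (A + B) = dilation d A + dilation d B"
  using assms by (intro eq_matI) (auto simp: dilation_def)

lemma sum_lessThan_add_split:
  "(\<Sum>i<m + (n :: nat). f i) = (\<Sum>i<m. f i) + (\<Sum>i<n. f (m + i) :: 'a :: comm_monoid_add)"
  by (induction n) (auto simp: add.assoc)

lemma l2_norm_dilation:
  assumes Z: "Z \<in> carrier_mat d d" and u: "u \<in> carrier_vec d" and w: "w \<in> carrier_vec d"
  shows "(l2_norm (dilation d Z *\<^sub>v (u @\<^sub>v w)))\<^sup>2 = (l2_norm (Z *\<^sub>v w))\<^sup>2 + (l2_norm (adj Z *\<^sub>v u))\<^sup>2"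
proof -
  have uw: "u @\<^sub>v w \<in> carrier_vec (d + d)" using u w by simp
  have 1: "vec_index (dilation d Z *\<^sub>v (u @\<^sub>v w)) i = vec_index (Z *\<^sub>v w) i" if "i < d" for i
    using that Z u w uw
    by (simp add: mult_vec_index[of _ "d + d" "d + d"] mult_vec_index[of _ d d] sum_lessThan_add_split
        dilation_def del: index_mult_mat_vec)
  have 2: "vec_index (dilation d Z *\<^sub>v (u @\<^sub>v w)) (d + i) = vec_index (adj Z *\<^sub>v u) i" if "i < d" for i
    using that Z u w uw
    by (simp add: mult_vec_index[of _ "d + d" "d + d"] mult_vec_index[of _ d d] sum_lessThan_add_split
        dilation_def del: index_mult_mat_vec)
  have "dilation d Z *\<^sub>v (u @\<^sub>v w) \<in> carrier_vec (d + d)"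
    using uw by (intro mult_mat_vec_carrier[of _ _ "d + d"]) auto
  then have "(l2_norm (dilation d Z *\<^sub>v (u @\<^sub>v w)))\<^sup>2
      = (\<Sum>i<d + d. (cmod (vec_index (dilation d Z *\<^sub>v (u @\<^sub>v w)) i))\<^sup>2)"
    by (rule l2_norm_sq)
  also have "\<dots> = (\<Sum>i<d. (cmod (vec_index (Z *\<^sub>v w) i))\<^sup>2) + (\<Sum>i<d. (cmod (vec_index (adj Z *\<^sub>v u) i))\<^sup>2)"
    unfolding sum_lessThan_add_split using 1 2 by (simp del: index_mult_mat_vec)
  also have "\<dots> = (l2_norm (Z *\<^sub>v w))\<^sup>2 + (l2_norm (adj Z *\<^sub>v u))\<^sup>2"
    using Z u w by (intro arg_cong2[where f = "(+)"] l2_norm_sq[symmetric] mult_mat_vec_carrier[of _ d d]) auto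
  finally show ?thesis .
qed

lemma l2_norm_append:
  assumes u: "u \<in> carrier_vec d" and w: "w \<in> carrier_vec d"
  shows "(l2_norm (u @\<^sub>v w))\<^sup>2 = (l2_norm u)\<^sup>2 + (l2_norm w)\<^sup>2"
  using assms
  by (simp add: l2_norm_sq[of _ "d + d"] l2_norm_sq[of _ d] sum_lessThan_add_split)

lemma mat_bound_dilation:
  assumes "mat_bound d Z r" "0 \<le> r"
  shows "mat_bound (d + d) (dilation d Z) r"
  unfolding mat_bound_def
proof (intro conjI ballI dilation_carrier)
  have Z: "Z \<in> carrier_mat d d" using assms by auto
  fix v :: "complex vec" assume "v \<in> carrier_vec (d + d)"
  then obtain u w where v: "v = u @\<^sub>v w" "u \<in> carrier_vec d" "w \<in> carrier_vec d"
    using vec_first_last_append[of v d d] by (metis vec_first_carrier vec_last_carrier)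
  have "(l2_norm (dilation d Z *\<^sub>v v))\<^sup>2 = (l2_norm (Z *\<^sub>v w))\<^sup>2 + (l2_norm (adj Z *\<^sub>v u))\<^sup>2"
    unfolding v(1) by (rule l2_norm_dilation[OF Z v(2,3)])
  also have "\<dots> \<le> (r * l2_norm w)\<^sup>2 + (r * l2_norm u)\<^sup>2"
    using v assms by (intro add_mono power_mono mat_boundD[of d] mat_bound_adj) auto
  also have "\<dots> = r\<^sup>2 * (l2_norm v)\<^sup>2"
    using v(2,3) by (simp add: v(1) l2_norm_append power_mult_distrib algebra_simps)
  also have "\<dots> = (r * l2_norm v)\<^sup>2" by (simp add: power_mult_distrib)
  finally show "l2_norm (dilation d Z *\<^sub>v v) \<le> r * l2_norm v"
    by (rule power2_le_imp_le) (use assms(2) in simp)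
qed

lemma op_norm_le_dilation:
  assumes Z: "Z \<in> carrier_mat d d"
  shows "op_norm Z \<le> op_norm (dilation d Z)"
proof (rule op_norm_le)
  show "mat_bound d Z (op_norm (dilation d Z))"
    unfolding mat_bound_def
  proof (intro conjI ballI Z)
    fix w :: "complex vec" assume w: "w \<in> carrier_vec d"
    have "(l2_norm (Z *\<^sub>v w))\<^sup>2 \<le> (l2_norm (dilation d Z *\<^sub>v (0\<^sub>v d @\<^sub>v w)))\<^sup>2"
      using l2_norm_dilation[OF Z zero_carrier_vec w] by simp
    then have "l2_norm (Z *\<^sub>v w) \<le> l2_norm (dilation d Z *\<^sub>v (0\<^sub>v d @\<^sub>v w))"
      by (rule power2_le_imp_le) simp
    also have "\<dots> \<le> op_norm (dilation d Z) * l2_norm (0\<^sub>v d @\<^sub>v w)"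
      using w by (intro mat_boundD[OF mat_bound_op_norm[OF dilation_carrier]]) auto
    also have "l2_norm (0\<^sub>v d @\<^sub>v w) = l2_norm w"
      using l2_norm_append[OF zero_carrier_vec w] by simp
    finally show "l2_norm (Z *\<^sub>v w) \<le> op_norm (dilation d Z) * l2_norm w" .
  qed
qed (rule op_norm_nonneg[OF dilation_carrier])

lemma fro2_pow:
  assumes "H \<in> carrier_mat n n" "adj H = H"
  shows "fro2 (H ^\<^sub>m k) = Re (tr (H ^\<^sub>m (2 * k)))"
  using tr_mult_adj[OF pow_carrier_mat[OF assms(1)], of k] adj_pow[OF assms]
    pow_mat_add[OF assms(1), of k k] by (metis Re_complex_of_real mult_2)

lemma op_norm_pow_le_tr_dilation:
  assumes Z: "Z \<in> carrier_mat d d"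
  shows "op_norm Z ^ (2 * 2 ^ p) \<le> Re (tr (dilation d Z ^\<^sub>m (2 * 2 ^ p)))"
proof -
  have "op_norm Z ^ (2 * 2 ^ p) = (op_norm Z ^ 2 ^ p)\<^sup>2" by (simp add: power_mult[symmetric] mult.commute)
  also have "\<dots> \<le> (op_norm (dilation d Z) ^ 2 ^ p)\<^sup>2"
    using op_norm_nonneg[OF Z] op_norm_le_dilation[OF Z] by (intro power_mono) auto
  also have "\<dots> \<le> fro2 (dilation d Z ^\<^sub>m (2 ^ p))"
    by (intro op_norm_pow_le_fro2[of _ "d + d"]) auto
  also have "\<dots> = Re (tr (dilation d Z ^\<^sub>m (2 * 2 ^ p)))"
    by (intro fro2_pow[of _ "d + d"]) auto
  finally show ?thesis .
qed

subsection \<open>The matrix exponential\<close>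

definition power_sum :: "nat \<Rightarrow> complex mat \<Rightarrow> (nat \<Rightarrow> complex) \<Rightarrow> nat \<Rightarrow> complex mat" where
  "power_sum n A c K = Matrix.mat n n (\<lambda>(i, j). \<Sum>k<K. c k * (A ^\<^sub>m k) $$ (i, j))"

lemma power_sum_carrier [simp]: "power_sum n A c K \<in> carrier_mat n n"
  by (simp add: power_sum_def)

lemma mat_bound_power_sum:
  assumes "mat_bound n A r" "0 \<le> r"
  shows "mat_bound n (power_sum n A c K) (\<Sum>k<K. cmod (c k) * r ^ k)"
proof (induction K)
  case 0
  have "power_sum n A c 0 = 0\<^sub>m n n" by (intro eq_matI) (auto simp: power_sum_def)
  moreover have "0\<^sub>m n n *\<^sub>v v = 0\<^sub>v n" if "v \<in> carrier_vec n" for v :: "complex vec"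
    using that by (intro eq_vecI) auto
  ultimately show ?case by (auto simp: mat_bound_def)
next
  case (Suc K)
  have A: "A \<in> carrier_mat n n" using assms by auto
  have "power_sum n A c (Suc K) = power_sum n A c K + c K \<cdot>\<^sub>m (A ^\<^sub>m K)"
    using A carrier_matD[OF pow_carrier_mat[OF A, of K]]
    by (intro eq_matI) (auto simp: power_sum_def simp del: pow_mat_dim)
  then show ?case
    using mat_bound_add[OF Suc mat_bound_smult[OF mat_bound_pow[OF assms]]] by simp
qed

lemma mat_bound_index:
  assumes "mat_bound n A r" "i < n" "j < n"
  shows "cmod (A $$ (i, j)) \<le> r"
proof -
  have A: "A \<in> carrier_mat n n" using assms by auto
  have 1: "(l2_norm (unit_vec n j))\<^sup>2 = 1"
    using assms by (simp add: l2_norm_sq[of _ n] unit_vec_def if_distrib if_distribR cong: if_cong)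
  then have 1: "l2_norm (unit_vec n j) = 1"
    using l2_norm_nonneg[of "unit_vec n j"] by (simp add: power2_eq_1_iff)
  define w where "w = A *\<^sub>v unit_vec n j"
  have w: "w \<in> carrier_vec n" using A by (simp add: w_def)
  have "vec_index w i = A $$ (i, j)"
    unfolding w_def using A assms by (simp add: mult_vec_index[of _ n n] unit_vec_def if_distrib if_distribR
        cong: if_cong del: index_mult_mat_vec)
  moreover have "(cmod (vec_index w i))\<^sup>2 \<le> (l2_norm w)\<^sup>2"
    unfolding l2_norm_sq[OF w] by (rule member_le_sum) (use assms in auto)
  ultimately have "(cmod (A $$ (i, j)))\<^sup>2 \<le> (l2_norm (A *\<^sub>v unit_vec n j))\<^sup>2"
    by (simp add: w_def)
  then have "cmod (A $$ (i, j)) \<le> l2_norm (A *\<^sub>v unit_vec n j)" by (rule power2_le_imp_le) simp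
  also have "\<dots> \<le> r * l2_norm (unit_vec n j)" by (intro mat_boundD[OF assms(1)]) simp
  finally show ?thesis using 1 by simp
qed

lemma tendsto_l2_norm:
  assumes "\<And>k. v k \<in> carrier_vec n" "w \<in> carrier_vec n"
    and "\<And>i. i < n \<Longrightarrow> (\<lambda>k. vec_index (v k) i) \<longlonglongrightarrow> vec_index w i"
  shows "(\<lambda>k. l2_norm (v k)) \<longlonglongrightarrow> l2_norm w"
proof -
  have "(\<lambda>k. L2_set (\<lambda>i. cmod (vec_index (v k) i)) {..<n}) \<longlonglongrightarrow> L2_set (\<lambda>i. cmod (vec_index w i)) {..<n}"
    unfolding L2_set_def using assms(3) by (intro tendsto_intros) auto
  moreover have "dim_vec (v k) = n" for k using assms(1)[of k] by auto
  ultimately show ?thesis using assms(2) by (simp add: l2_norm_def)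
qed

text \<open>\<open>mat_exp\<close> is a limit of entries only. For a fixed vector the norm of its
  image is continuous in the entries, so a common bound on partial sums passes to the limit.\<close>

lemma mat_bound_limit:
  assumes B: "\<And>K. mat_bound n (B K) R" and M: "M \<in> carrier_mat n n"
    and lim: "\<And>i j. i < n \<Longrightarrow> j < n \<Longrightarrow> (\<lambda>K. B K $$ (i, j)) \<longlonglongrightarrow> M $$ (i, j)"
  shows "mat_bound n M R"
  unfolding mat_bound_def
proof (intro conjI ballI M)
  fix v :: "complex vec" assume v: "v \<in> carrier_vec n"
  have Bc: "B K \<in> carrier_mat n n" for K using B by auto
  have "(\<lambda>K. l2_norm (B K *\<^sub>v v)) \<longlonglongrightarrow> l2_norm (M *\<^sub>v v)"
  proof (rule tendsto_l2_norm[of _ n])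
    fix i assume i: "i < n"
    have "(\<lambda>K. \<Sum>j<n. B K $$ (i, j) * vec_index v j) \<longlonglongrightarrow> (\<Sum>j<n. M $$ (i, j) * vec_index v j)"
      using i by (intro tendsto_intros lim) auto
    then show "(\<lambda>K. vec_index (B K *\<^sub>v v) i) \<longlonglongrightarrow> vec_index (M *\<^sub>v v) i"
      using i v M Bc by (simp add: mult_vec_index[of _ n n] del: index_mult_mat_vec)
  qed (use M Bc v in \<open>auto intro: mult_mat_vec_carrier\<close>)
  then show "l2_norm (M *\<^sub>v v) \<le> R * l2_norm v"
    by (rule LIMSEQ_le_const2) (use mat_boundD[OF B v] in auto)
qed

lemma mat_exp_index_sums:
  assumes "mat_bound n A r" "0 \<le> r" "i < n" "j < n"
  shows "(\<lambda>k. complex_of_real (1 / fact k) * (A ^\<^sub>m k) $$ (i, j)) sums (mat_exp A $$ (i, j))"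
proof -
  have A: "A \<in> carrier_mat n n" using assms by auto
  have "summable (\<lambda>k. (A ^\<^sub>m k) $$ (i, j) / fact k)"
  proof (rule summable_comparison_test')
    show "summable (\<lambda>k. r ^ k / fact k)"
      using summable_exp[of r] by (simp add: field_simps)
    show "norm ((A ^\<^sub>m k) $$ (i, j) / fact k) \<le> r ^ k / fact k" if "0 \<le> k" for k
      using mat_bound_index[OF mat_bound_pow[OF assms(1,2)] assms(3,4), of k]
      by (simp add: norm_divide divide_right_mono)
  qed
  then have "(\<lambda>k. (A ^\<^sub>m k) $$ (i, j) / fact k) sums (mat_exp A $$ (i, j))"
    using A assms by (simp add: mat_exp_def summable_sums)
  then show ?thesis by (simp add: mult.commute)
qed

lemma mat_exp_carrier [simp]: "A \<in> carrier_mat n n \<Longrightarrow> mat_exp A \<in> carrier_mat n n"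
  by (simp add: mat_exp_def)

text \<open>With nonnegative coefficients, the scalar series at \<open>r\<close> dominates the
  matrix series term by term. It serves both \<open>mat_exp A\<close> and its difference from
  \<open>(I + A / n) ^ n\<close>.\<close>

lemma mat_bound_power_sum_limit:
  assumes A: "mat_bound n A r" "0 \<le> r" and M: "M \<in> carrier_mat n n"
    and lim: "\<And>i j. i < n \<Longrightarrow> j < n \<Longrightarrow> (\<lambda>k. complex_of_real (c k) * (A ^\<^sub>m k) $$ (i, j)) sums (M $$ (i, j))"
    and c: "\<And>k. 0 \<le> c k" "(\<lambda>k. c k * r ^ k) sums R"
  shows "mat_bound n M R"
proof (rule mat_bound_limit[OF _ M])
  fix K
  have "(\<Sum>k<K. cmod (complex_of_real (c k)) * r ^ k) = (\<Sum>k<K. c k * r ^ k)"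
    using c(1) by simp
  also have "\<dots> \<le> R"
    unfolding sums_unique[OF c(2)]
    using c A(2) by (intro sum_le_suminf) (auto simp: sums_iff)
  finally show "mat_bound n (power_sum n A (\<lambda>k. complex_of_real (c k)) K) R"
    by (rule mat_bound_mono[OF mat_bound_power_sum[OF A]])
next
  fix i j assume "i < n" "j < n"
  then show "(\<lambda>K. power_sum n A (\<lambda>k. complex_of_real (c k)) K $$ (i, j)) \<longlonglongrightarrow> M $$ (i, j)"
    using lim[of i j] by (simp add: power_sum_def sums_def)
qed

lemma mat_bound_mat_exp:
  assumes "mat_bound n A r" "0 \<le> r"
  shows "mat_bound n (mat_exp A) (exp r)"
proof (rule mat_bound_power_sum_limit[OF assms _ mat_exp_index_sums[OF assms]])
  show "(\<lambda>k. 1 / fact k * r ^ k) sums exp r"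
    using exp_converges[of r] by (simp add: field_simps scaleR_conv_of_real)
qed (use assms in auto)

text \<open>The binomial theorem, available because the identity commutes with \<open>B\<close>. It
  is stated entrywise to match the entrywise series of \<open>mat_exp\<close>.\<close>

lemma one_plus_pow_index:
  fixes B :: "complex mat"
  assumes B: "B \<in> carrier_mat n n" and ij: "i < n" "j < n"
  shows "((1\<^sub>m n + B) ^\<^sub>m m) $$ (i, j) = (\<Sum>k\<le>m. of_nat (m choose k) * (B ^\<^sub>m k) $$ (i, j))"
  using ij
proof (induction m arbitrary: i j)
  case 0
  then show ?case using B by simp
next
  case (Suc m)
  let ?E = "(1\<^sub>m n + B) ^\<^sub>m m"
  define b where "b k = (B ^\<^sub>m k) $$ (i, j)" for k
  have E: "?E \<in> carrier_mat n n" using B by simp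
  have "(1\<^sub>m n + B) ^\<^sub>m Suc m = (1\<^sub>m n + B) * ?E"
    using B by (intro pow_mat_Suc_left[of _ n]) simp
  also have "\<dots> = ?E + B * ?E"
    using B E by (simp add: add_mult_distrib_mat[of _ n n _ _ n])
  finally have "((1\<^sub>m n + B) ^\<^sub>m Suc m) $$ (i, j) = ?E $$ (i, j) + (B * ?E) $$ (i, j)"
    using B E Suc.prems by (simp del: index_mult_mat(1) pow_mat.simps)
  also have "(B * ?E) $$ (i, j) = (\<Sum>l<n. \<Sum>k\<le>m. of_nat (m choose k) * (B $$ (i, l) * (B ^\<^sub>m k) $$ (l, j)))"
    unfolding mult_index[OF B E Suc.prems] using Suc
    by (intro sum.cong refl) (simp add: sum_distrib_left mult.left_commute)
  also have "\<dots> = (\<Sum>k\<le>m. of_nat (m choose k) * (B * B ^\<^sub>m k) $$ (i, j))"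
    using B Suc.prems
    by (subst sum.swap) (simp add: mult_index[of _ n n _ n] sum_distrib_left del: index_mult_mat(1))
  also have "\<dots> = (\<Sum>k\<le>m. of_nat (m choose k) * b (Suc k))"
    unfolding b_def pow_mat_Suc_left[OF B] ..
  also have "?E $$ (i, j) = (\<Sum>k\<le>m. of_nat (m choose k) * b k)"
    using Suc by (simp add: b_def)
  \<comment> \<open>The added term vanishes because \<open>m choose Suc m = 0\<close>; after an
    index shift the two sums combine by Pascal's rule.\<close>
  also have "(\<Sum>k\<le>m. of_nat (m choose k) * b k) = (\<Sum>k\<le>Suc m. of_nat (m choose k) * b k)" by simp
  also have "\<dots> = b 0 + (\<Sum>k\<le>m. of_nat (m choose Suc k) * b (Suc k))"
    by (subst sum.atMost_Suc_shift) simp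
  also have "b 0 + (\<Sum>k\<le>m. of_nat (m choose Suc k) * b (Suc k)) + (\<Sum>k\<le>m. of_nat (m choose k) * b (Suc k))
      = (\<Sum>k\<le>Suc m. of_nat (Suc m choose k) * b k)"
    unfolding sum.atMost_Suc_shift[of _ m] by (simp add: sum.distrib algebra_simps)
  finally show ?case by (simp only: b_def)
qed

lemma smult_pow_mat:
  assumes "A \<in> carrier_mat n n"
  shows "(c \<cdot>\<^sub>m A) ^\<^sub>m k = (c ^ k) \<cdot>\<^sub>m (A ^\<^sub>m (k :: nat) :: complex mat)"
proof (induction k)
  case 0
  show ?case using assms by (intro eq_matI) auto
next
  case (Suc k)
  have "(c ^ k \<cdot>\<^sub>m A ^\<^sub>m k) * (c \<cdot>\<^sub>m A) = (c ^ k * c) \<cdot>\<^sub>m (A ^\<^sub>m k * A)"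
    using assms
    by (simp add: mult_smult_distrib[of _ n n _ n] mult_smult_assoc_mat[of _ n n _ n])
      (intro eq_matI; auto)
  then show ?case using Suc by (simp add: mult.commute)
qed

text \<open>With \<open>x = L / n\<close> in \<open>[0, 1]\<close>, the inequality
  \<open>ln (1 + x) >= x - x^2\<close> gives \<open>(1 + x) ^ n >= exp (L - L^2 / n)\<close>, and
  \<open>exp (- y) >= 1 - y\<close> linearizes the correction.\<close>

lemma exp_minus_one_plus_pow_le:
  fixes L :: real
  assumes "1 \<le> n" "0 \<le> L" "L \<le> sqrt (real n)"
  shows "exp L - (1 + L / real n) ^ n \<le> L\<^sup>2 * exp L / real n"
proof -
  define x where "x = L / real n"
  have n: "real n \<ge> 1" using assms by simp
  have "sqrt (real n) \<le> real n"
    using n by (simp add: real_le_lsqrt power2_eq_square)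
  then have x: "0 \<le> x" "x \<le> 1" using assms n by (auto simp: x_def divide_simps)
  have "exp L * (1 - L\<^sup>2 / real n) \<le> exp L * exp (- (L\<^sup>2 / real n))"
    using exp_ge_add_one_self[of "- (L\<^sup>2 / real n)"] by (intro mult_left_mono) auto
  also have "\<dots> = exp (real n * (x - x\<^sup>2))"
    using n by (simp add: x_def power2_eq_square field_simps flip: exp_add)
  also have "\<dots> \<le> exp (real n * ln (1 + x))"
    using ln_one_plus_pos_lower_bound[OF x] n by (simp add: mult_left_mono)
  also have "\<dots> = (1 + x) ^ n"
    using x by (simp add: exp_of_nat_mult)
  finally show ?thesis by (simp add: x_def algebra_simps)
qed

text \<open>The coefficients of \<open>e\<^sup>x - (1 + x / n)\<^sup>n\<close> are nonnegative, so the operator norm of the matrix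
  expression is at most its value at \<open>x = r\<close>.\<close>

lemma mat_bound_exp_minus_pow:
  assumes A: "mat_bound d A r" "0 \<le> r" and n: "1 \<le> n"
  shows "mat_bound d (mat_exp A - (1\<^sub>m d + (1 / of_nat n) \<cdot>\<^sub>m A) ^\<^sub>m n) (exp r - (1 + r / real n) ^ n)"
proof -
  have Ac: "A \<in> carrier_mat d d" using A by auto
  define b where "b k = real (n choose k) / real n ^ k" for k
  define c where "c k = 1 / fact k - b k" for k
  have n0: "real n > 0" using n by simp
  have b0: "b k = 0" if "k \<notin> {..n}" for k using that by (simp add: b_def binomial_eq_0)
  \<comment> \<open>The falling product \<open>n (n - 1) ... (n - k + 1)\<close> is at most
    \<open>n ^ k\<close>.\<close>
  have "0 \<le> c k" for k
  proof -
    have "real (n choose k) * fact k \<le> real n ^ k"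
      using binomial_fact_pow[of n k] by (metis of_nat_fact of_nat_le_iff of_nat_mult of_nat_power)
    then show ?thesis using n0 by (simp add: c_def b_def field_simps)
  qed
  moreover have "(\<lambda>k. c k * r ^ k) sums (exp r - (1 + r / real n) ^ n)"
  proof -
    have "(\<lambda>k. b k * r ^ k) sums (\<Sum>k\<le>n. b k * r ^ k)"
      using b0 by (intro sums_finite) auto
    also have "(\<Sum>k\<le>n. b k * r ^ k) = (1 + r / real n) ^ n"
      using binomial_ring[of "r / real n" 1 n] by (simp add: b_def power_divide add.commute)
    finally have "(\<lambda>k. 1 / fact k * r ^ k - b k * r ^ k) sums (exp r - (1 + r / real n) ^ n)"
      using exp_converges[of r] by (intro sums_diff) (auto simp: field_simps)
    then show ?thesis by (simp add: c_def algebra_simps)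
  qed
  moreover have "(\<lambda>k. complex_of_real (c k) * (A ^\<^sub>m k) $$ (i, j)) sums
      (mat_exp A - (1\<^sub>m d + (1 / of_nat n) \<cdot>\<^sub>m A) ^\<^sub>m n) $$ (i, j)" if ij: "i < d" "j < d" for i j
  proof -
    let ?B = "(1 / of_nat n) \<cdot>\<^sub>m A"
    have "(\<lambda>k. complex_of_real (b k) * (A ^\<^sub>m k) $$ (i, j)) sums (\<Sum>k\<le>n. complex_of_real (b k) * (A ^\<^sub>m k) $$ (i, j))"
      using b0 by (intro sums_finite) auto
    also have "(\<Sum>k\<le>n. complex_of_real (b k) * (A ^\<^sub>m k) $$ (i, j)) = (\<Sum>k\<le>n. of_nat (n choose k) * (?B ^\<^sub>m k) $$ (i, j))"
      using ij Ac carrier_matD[OF pow_carrier_mat[OF Ac]]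
      by (intro sum.cong refl) (simp add: smult_pow_mat[OF Ac] b_def power_divide)
    also have "\<dots> = ((1\<^sub>m d + ?B) ^\<^sub>m n) $$ (i, j)"
      using Ac ij by (intro one_plus_pow_index[symmetric]) auto
    finally have "(\<lambda>k. complex_of_real (1 / fact k) * (A ^\<^sub>m k) $$ (i, j) - complex_of_real (b k) * (A ^\<^sub>m k) $$ (i, j))
        sums (mat_exp A $$ (i, j) - ((1\<^sub>m d + ?B) ^\<^sub>m n) $$ (i, j))"
      by (rule sums_diff[OF mat_exp_index_sums[OF A ij]])
    then show ?thesis
      using ij Ac carrier_matD[OF pow_carrier_mat[of "1\<^sub>m d + ?B" d n]]
      by (simp add: c_def algebra_simps)
  qed
  ultimately show ?thesis
    using Ac by (intro mat_bound_power_sum_limit[OF A, where c = c]) auto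
qed

subsection \<open>Measurability of matrix-valued maps\<close>

lemma space_mat_borel [simp]: "space (mat_borel d) = carrier_mat d d"
  by (simp add: mat_borel_def space_measure_of_conv)

lemma measurable_mat_index:
  assumes "F \<in> measurable M (mat_borel d)" "i < d" "j < d"
  shows "(\<lambda>x. F x $$ (i, j)) \<in> borel_measurable M"
proof -
  have "(\<lambda>A. A $$ (i, j)) \<in> borel_measurable (mat_borel d)"
  proof (rule measurableI)
    fix B :: "complex set" assume "B \<in> sets borel"
    then have "{A \<in> carrier_mat d d. A $$ (i, j) \<in> B} \<in> sets (mat_borel d)"
      unfolding mat_borel_def using assms(2,3)
      by (subst sets_measure_of) (auto intro!: sigma_sets.Basic)
    moreover have "(\<lambda>A. A $$ (i, j)) -` B \<inter> space (mat_borel d) = {A \<in> carrier_mat d d. A $$ (i, j) \<in> B}"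
      by auto
    ultimately show "(\<lambda>A. A $$ (i, j)) -` B \<inter> space (mat_borel d) \<in> sets (mat_borel d)" by simp
  qed simp
  then show ?thesis by (rule measurable_compose[OF assms(1)])
qed

lemma measurable_mat_borelI:
  assumes "\<And>x. x \<in> space M \<Longrightarrow> F x \<in> carrier_mat d d"
    and "\<And>i j. i < d \<Longrightarrow> j < d \<Longrightarrow> (\<lambda>x. F x $$ (i, j)) \<in> borel_measurable M"
  shows "F \<in> measurable M (mat_borel d)"
  unfolding mat_borel_def
proof (rule measurable_measure_of)
  fix Y :: "complex mat set" assume "Y \<in> {{A \<in> carrier_mat d d. A $$ (i, j) \<in> B} | i j B. i < d \<and> j < d \<and> B \<in> sets borel}"
  then obtain i j B where Y: "Y = {A \<in> carrier_mat d d. A $$ (i, j) \<in> B}" "i < d" "j < d" "B \<in> sets borel"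
    by blast
  then have "F -` Y \<inter> space M = (\<lambda>x. F x $$ (i, j)) -` B \<inter> space M"
    using assms(1) by auto
  then show "F -` Y \<inter> space M \<in> sets M"
    using measurable_sets[OF assms(2)[OF Y(2,3)] Y(4)] by simp
qed (use assms(1) in auto)

lemma measurable_mat_carrier: "F \<in> measurable M (mat_borel d) \<Longrightarrow> x \<in> space M \<Longrightarrow> F x \<in> carrier_mat d d"
  using measurable_space[of F M "mat_borel d" x] by simp

lemma measurable_mat_mult:
  assumes F: "F \<in> measurable M (mat_borel d)" and G: "G \<in> measurable M (mat_borel d)"
  shows "(\<lambda>x. F x * G x) \<in> measurable M (mat_borel d)"
proof (rule measurable_mat_borelI)
  fix i j assume ij: "i < d" "j < d"
  have "(\<lambda>x. \<Sum>l<d. F x $$ (i, l) * G x $$ (l, j)) \<in> borel_measurable M"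
    using ij by (intro borel_measurable_sum borel_measurable_times measurable_mat_index[OF F] measurable_mat_index[OF G]) auto
  also have "?this \<longleftrightarrow> (\<lambda>x. (F x * G x) $$ (i, j)) \<in> borel_measurable M"
    using ij by (intro measurable_cong)
      (simp add: mult_index[OF measurable_mat_carrier[OF F] measurable_mat_carrier[OF G]] del: index_mult_mat(1))
  finally show "(\<lambda>x. (F x * G x) $$ (i, j)) \<in> borel_measurable M" .
qed (use measurable_mat_carrier[OF F] measurable_mat_carrier[OF G] in auto)

lemma measurable_mat_add:
  assumes F: "F \<in> measurable M (mat_borel d)" and G: "G \<in> measurable M (mat_borel d)"
  shows "(\<lambda>x. F x + G x) \<in> measurable M (mat_borel d)"
proof (rule measurable_mat_borelI)
  fix i j assume ij: "i < d" "j < d"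
  have "(\<lambda>x. F x $$ (i, j) + G x $$ (i, j)) \<in> borel_measurable M"
    using ij by (intro borel_measurable_add measurable_mat_index[OF F] measurable_mat_index[OF G])
  also have "?this \<longleftrightarrow> (\<lambda>x. (F x + G x) $$ (i, j)) \<in> borel_measurable M"
    using ij carrier_matD[OF measurable_mat_carrier[OF G]] by (intro measurable_cong) simp
  finally show "(\<lambda>x. (F x + G x) $$ (i, j)) \<in> borel_measurable M" .
qed (use measurable_mat_carrier[OF F] measurable_mat_carrier[OF G] in auto)

lemma measurable_mat_smult:
  assumes F: "F \<in> measurable M (mat_borel d)"
  shows "(\<lambda>x. c \<cdot>\<^sub>m F x) \<in> measurable M (mat_borel d)"
proof (rule measurable_mat_borelI)
  fix i j assume ij: "i < d" "j < d"
  have "(\<lambda>x. c * F x $$ (i, j)) \<in> borel_measurable M"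
    using ij by (intro borel_measurable_times measurable_mat_index[OF F]) auto
  also have "?this \<longleftrightarrow> (\<lambda>x. (c \<cdot>\<^sub>m F x) $$ (i, j)) \<in> borel_measurable M"
    using ij carrier_matD[OF measurable_mat_carrier[OF F]] by (intro measurable_cong) simp
  finally show "(\<lambda>x. (c \<cdot>\<^sub>m F x) $$ (i, j)) \<in> borel_measurable M" .
qed (use measurable_mat_carrier[OF F] in auto)

lemma measurable_mat_const: "A \<in> carrier_mat d d \<Longrightarrow> (\<lambda>x. A) \<in> measurable M (mat_borel d)"
  by (rule measurable_const) simp

lemma measurable_mat_minus:
  assumes F: "F \<in> measurable M (mat_borel d)" and A: "A \<in> carrier_mat d d"
  shows "(\<lambda>x. F x - A) \<in> measurable M (mat_borel d)"
proof -
  have "(\<lambda>x. F x + (-1) \<cdot>\<^sub>m A) \<in> measurable M (mat_borel d)"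
    using A by (intro measurable_mat_add F measurable_mat_const) auto
  also have "?this \<longleftrightarrow> (\<lambda>x. F x - A) \<in> measurable M (mat_borel d)"
    using measurable_mat_carrier[OF F] A by (intro measurable_cong eq_matI) auto
  finally show ?thesis .
qed

lemma measurable_mat_pow:
  assumes F: "F \<in> measurable M (mat_borel d)"
  shows "(\<lambda>x. F x ^\<^sub>m k) \<in> measurable M (mat_borel d)"
proof (induction k)
  case 0
  have "(\<lambda>x. 1\<^sub>m d) \<in> measurable M (mat_borel d)" by (intro measurable_mat_const) simp
  also have "?this \<longleftrightarrow> (\<lambda>x. F x ^\<^sub>m 0) \<in> measurable M (mat_borel d)"
    using carrier_matD[OF measurable_mat_carrier[OF F]] by (intro measurable_cong) simp
  finally show ?case .
next
  case (Suc k)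
  then show ?case using measurable_mat_mult[OF Suc F] by simp
qed

lemma measurable_mat_dilation:
  assumes F: "F \<in> measurable M (mat_borel d)"
  shows "(\<lambda>x. dilation d (F x)) \<in> measurable M (mat_borel (d + d))"
proof (rule measurable_mat_borelI)
  fix i j assume ij: "i < d + d" "j < d + d"
  have cnj: "cnj \<in> borel_measurable borel"
    by (intro borel_measurable_continuous_onI continuous_intros)
  consider "i < d" "d \<le> j" | "d \<le> i" "j < d" | "i < d \<longleftrightarrow> j < d" by linarith
  then show "(\<lambda>x. dilation d (F x) $$ (i, j)) \<in> borel_measurable M"
  proof cases
    case 1
    then have "(\<lambda>x. F x $$ (i, j - d)) \<in> borel_measurable M"
      using ij by (intro measurable_mat_index[OF F]) auto
    then show ?thesis using 1 ij by (simp add: dilation_def)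
  next
    case 2
    then have "(\<lambda>x. cnj (F x $$ (j, i - d))) \<in> borel_measurable M"
      using ij by (intro measurable_compose[OF _ cnj] measurable_mat_index[OF F]) auto
    then show ?thesis using 2 ij by (simp add: dilation_def)
  next
    case 3
    then show ?thesis using ij by (auto simp: dilation_def)
  qed
qed simp

lemma measurable_tr:
  assumes F: "F \<in> measurable M (mat_borel d)"
  shows "(\<lambda>x. tr (F x)) \<in> borel_measurable M"
proof -
  have "(\<lambda>x. \<Sum>i<d. F x $$ (i, i)) \<in> borel_measurable M"
    by (intro borel_measurable_sum measurable_mat_index[OF F]) auto
  also have "?this \<longleftrightarrow> (\<lambda>x. tr (F x)) \<in> borel_measurable M"
    using carrier_matD[OF measurable_mat_carrier[OF F]] by (intro measurable_cong) (simp add: tr_def)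
  finally show ?thesis .
qed

section \<open>Measurability of operator norm events\<close>

lemma countable_dense_vecs:
  obtains Q :: "complex vec set" where "countable Q" "Q \<subseteq> carrier_vec d"
    "\<And>v. v \<in> carrier_vec d \<Longrightarrow> \<exists>w. (\<forall>k. w k \<in> Q) \<and> (\<forall>i<d. (\<lambda>k. vec_index (w k) i) \<longlonglongrightarrow> vec_index v i)"
proof -
  obtain D :: "complex set" where D: "countable D" "\<And>X. open X \<Longrightarrow> X \<noteq> {} \<Longrightarrow> \<exists>d\<in>D. d \<in> X"
    by (rule countable_dense_setE) auto
  define Q where "Q = {v \<in> carrier_vec d. \<forall>i<d. vec_index v i \<in> D}"
  have "Q \<subseteq> vec_of_list ` lists D"
  proof
    fix v assume "v \<in> Q"
    then have "list_of_vec v \<in> lists D"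
      by (auto simp: Q_def in_lists_conv_set in_set_conv_nth list_of_vec_index)
    then show "v \<in> vec_of_list ` lists D"
      using vec_list[of v] by (metis image_eqI)
  qed
  then have "countable Q" using D(1) by (meson countable_image countable_lists countable_subset)
  moreover have "Q \<subseteq> carrier_vec d" by (auto simp: Q_def)
  moreover have "\<exists>w. (\<forall>k. w k \<in> Q) \<and> (\<forall>i<d. (\<lambda>k. vec_index (w k) i) \<longlonglongrightarrow> vec_index v i)"
    if "v \<in> carrier_vec d" for v
  proof -
    have "\<exists>z\<in>D. z \<in> ball (vec_index v i) (1 / real (Suc k))" for i k
      by (intro D(2)) auto
    then obtain z where z: "\<And>i k. z i k \<in> D" "\<And>i k. z i k \<in> ball (vec_index v i) (1 / real (Suc k))"
      by metis
    have "(\<lambda>k. z i k) \<longlonglongrightarrow> vec_index v i" for i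
    proof (rule metric_tendsto_imp_tendsto)
      show "(\<lambda>k. 1 / real (Suc k)) \<longlonglongrightarrow> 0" by (rule LIMSEQ_Suc[OF lim_1_over_n])
      show "\<forall>\<^sub>F k in sequentially. dist (z i k) (vec_index v i) \<le> dist (1 / real (Suc k)) 0"
      proof (intro always_eventually allI)
        fix k
        show "dist (z i k) (vec_index v i) \<le> dist (1 / real (Suc k)) 0"
          using z(2)[of i k] by (simp add: dist_commute)
      qed
    qed
    then show ?thesis
      using z(1) by (intro exI[of _ "\<lambda>k. Matrix.vec d (\<lambda>i. z i k)"]) (auto simp: Q_def)
  qed
  ultimately show ?thesis by (rule that)
qed

text \<open>The defining inequality is closed in \<open>v\<close>, so testing it on a countable
  dense set of vectors suffices and the event is a countable intersection.\<close>

lemma mat_bound_measurable: "{A \<in> carrier_mat d d. mat_bound d A r} \<in> sets (mat_borel d)"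
proof -
  obtain Q :: "complex vec set" where Q: "countable Q" "Q \<subseteq> carrier_vec d"
    "\<And>v. v \<in> carrier_vec d \<Longrightarrow> \<exists>w. (\<forall>k. w k \<in> Q) \<and> (\<forall>i<d. (\<lambda>k. vec_index (w k) i) \<longlonglongrightarrow> vec_index v i)"
    using countable_dense_vecs[of d] by blast
  have eq: "mat_bound d A r \<longleftrightarrow> (\<forall>v\<in>Q. l2_norm (A *\<^sub>v v) \<le> r * l2_norm v)" if A: "A \<in> carrier_mat d d" for A
  proof
    assume "mat_bound d A r"
    then show "\<forall>v\<in>Q. l2_norm (A *\<^sub>v v) \<le> r * l2_norm v" using Q(2) by (auto intro: mat_boundD)
  next
    assume *: "\<forall>v\<in>Q. l2_norm (A *\<^sub>v v) \<le> r * l2_norm v"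
    show "mat_bound d A r"
      unfolding mat_bound_def
    proof (intro conjI ballI A)
      fix v :: "complex vec" assume v: "v \<in> carrier_vec d"
      then obtain w where w: "\<And>k. w k \<in> Q" "\<And>i. i < d \<Longrightarrow> (\<lambda>k. vec_index (w k) i) \<longlonglongrightarrow> vec_index v i"
        using Q(3) by metis
      have wc: "w k \<in> carrier_vec d" for k using w(1) Q(2) by auto
      have "(\<lambda>k. l2_norm (w k)) \<longlonglongrightarrow> l2_norm v"
        by (rule tendsto_l2_norm[OF wc v w(2)])
      then have l1: "(\<lambda>k. r * l2_norm (w k)) \<longlonglongrightarrow> r * l2_norm v" by (intro tendsto_intros)
      have l2: "(\<lambda>k. l2_norm (A *\<^sub>v w k)) \<longlonglongrightarrow> l2_norm (A *\<^sub>v v)"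
      proof (rule tendsto_l2_norm[of _ d])
        fix i assume i: "i < d"
        have "(\<lambda>k. \<Sum>l<d. A $$ (i, l) * vec_index (w k) l) \<longlonglongrightarrow> (\<Sum>l<d. A $$ (i, l) * vec_index v l)"
          by (intro tendsto_intros w(2)) auto
        then show "(\<lambda>k. vec_index (A *\<^sub>v w k) i) \<longlonglongrightarrow> vec_index (A *\<^sub>v v) i"
          using i A v wc by (simp add: mult_vec_index[of _ d d] del: index_mult_mat_vec)
      qed (use A wc v in \<open>auto intro: mult_mat_vec_carrier\<close>)
      show "l2_norm (A *\<^sub>v v) \<le> r * l2_norm v"
        by (rule LIMSEQ_le[OF l2 l1]) (use * w(1) in auto)
    qed
  qed
  have "{A \<in> space (mat_borel d). \<forall>v\<in>Q. l2_norm (A *\<^sub>v v) \<le> r * l2_norm v} \<in> sets (mat_borel d)"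
  proof -
    have "Q \<noteq> {}" using Q(3)[OF zero_carrier_vec] by auto
    then obtain q :: "nat \<Rightarrow> complex vec" where q: "range q = Q"
      using range_from_nat_into[OF _ Q(1)] by blast
    have pred: "Measurable.pred (mat_borel d) (\<lambda>A. l2_norm (A *\<^sub>v v) \<le> r * l2_norm v)" if "v \<in> Q" for v
    proof -
      have v: "v \<in> carrier_vec d" using Q(2) that by auto
      have "(\<lambda>A. L2_set (\<lambda>i. cmod (\<Sum>l<d. A $$ (i, l) * vec_index v l)) {..<d}) \<in> borel_measurable (mat_borel d)"
        unfolding L2_set_def
        by (intro measurable_compose[OF _ borel_measurable_sqrt] borel_measurable_sum borel_measurable_power measurable_compose[OF _ borel_measurable_norm]
            borel_measurable_times measurable_mat_index[of "\<lambda>A. A"] borel_measurable_const) auto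
      also have "?this \<longleftrightarrow> (\<lambda>A. l2_norm (A *\<^sub>v v)) \<in> borel_measurable (mat_borel d)"
        using v by (intro measurable_cong)
          (auto simp: l2_norm_def mult_vec_index[of _ d d] simp del: index_mult_mat_vec intro!: L2_set_cong)
      finally have [measurable]: "(\<lambda>A. l2_norm (A *\<^sub>v v)) \<in> borel_measurable (mat_borel d)" .
      show ?thesis by measurable
    qed
    have "{A \<in> space (mat_borel d). \<forall>k. l2_norm (A *\<^sub>v q k) \<le> r * l2_norm (q k)} \<in> sets (mat_borel d)"
      using q by (intro predE pred_intros_countable(1) pred) auto
    then show ?thesis unfolding q[symmetric] by simp
  qed
  also have "{A \<in> space (mat_borel d). \<forall>v\<in>Q. l2_norm (A *\<^sub>v v) \<le> r * l2_norm v} = {A \<in> carrier_mat d d. mat_bound d A r}"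
    using eq by auto
  finally show ?thesis .
qed

lemma measurable_op_norm_le:
  assumes F: "F \<in> measurable M (mat_borel d)"
  shows "{x \<in> space M. op_norm (F x) \<le> r} \<in> sets M"
proof (cases "0 \<le> r")
  case True
  have "{x \<in> space M. op_norm (F x) \<le> r} = F -` {A \<in> carrier_mat d d. mat_bound d A r} \<inter> space M"
    using measurable_mat_carrier[OF F] op_norm_le_iff[OF _ True] by blast
  then show ?thesis using measurable_sets[OF F mat_bound_measurable] by simp
next
  case False
  then have "{x \<in> space M. op_norm (F x) \<le> r} = {}"
    using op_norm_nonneg[OF measurable_mat_carrier[OF F]] by force
  then show ?thesis by (simp only: sets.empty_sets)
qed

subsection \<open>One step of the martingale\<close>

lemma integrable_mat_index:
  assumes "prob_space D" and F: "F \<in> measurable D (mat_borel d)"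
    and bound: "AE A in D. mat_bound d (F A) r" and ij: "i < d" "j < d"
  shows "integrable D (\<lambda>A. F A $$ (i, j))"
proof -
  interpret prob_space D by fact
  show ?thesis
    by (rule integrable_const_bound[where B = r])
      (use bound mat_bound_index[OF _ ij] measurable_mat_index[OF F ij] in auto)
qed

text \<open>The form in which the martingale property enters: \<open>B\<close> will depend on the
  past only, and the trace is a linear combination of entries of \<open>F A\<close> and their
  conjugates, all of mean zero.\<close>

lemma integral_linear_dilation:
  assumes "prob_space D" and F: "F \<in> measurable D (mat_borel d)"
    and bound: "AE A in D. mat_bound d (F A) r"
    and zero: "\<And>i j. i < d \<Longrightarrow> j < d \<Longrightarrow> (\<integral>A. F A $$ (i, j) \<partial>D) = 0"
    and B: "B \<in> carrier_mat (d + d) (d + d)"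
  shows "integrable D (\<lambda>A. Re (tr (B * dilation d (F A))))"
    and "(\<integral>A. Re (tr (B * dilation d (F A))) \<partial>D) = 0"
proof -
  have entry: "has_bochner_integral D (\<lambda>A. dilation d (F A) $$ (i, j)) 0"
    if ij: "i < d + d" "j < d + d" for i j
  proof -
    have hF: "has_bochner_integral D (\<lambda>A. F A $$ (i, j)) 0" if "i < d" "j < d" for i j
      using integrable_mat_index[OF assms(1) F bound that] zero[OF that]
      by (simp add: has_bochner_integral_iff)
    consider "i < d" "d \<le> j" | "d \<le> i" "j < d" | "i < d \<longleftrightarrow> j < d" by linarith
    then show ?thesis
    proof cases
      case 1
      then show ?thesis using hF[of i "j - d"] ij by (simp add: dilation_def)
    next
      case 2
      then have "has_bochner_integral D (\<lambda>A. cnj (F A $$ (j, i - d))) 0"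
        using hF[of j "i - d"] ij by (simp add: has_bochner_integral_iff)
      then show ?thesis using 2 ij by (simp add: dilation_def)
    next
      case 3
      then have "dilation d Z $$ (i, j) = 0" for Z using ij by (auto simp: dilation_def)
      then show ?thesis by (simp add: has_bochner_integral_zero)
    qed
  qed
  have "has_bochner_integral D (\<lambda>A. \<Sum>i<d + d. \<Sum>j<d + d. B $$ (i, j) * dilation d (F A) $$ (j, i))
      (\<Sum>i<d + d. \<Sum>j<d + d. B $$ (i, j) * 0)"
    by (intro has_bochner_integral_sum has_bochner_integral_mult_right entry) auto
  then have "has_bochner_integral D (\<lambda>A. tr (B * dilation d (F A))) 0"
    by (simp add: tr_mult[OF B dilation_carrier])
  then show "integrable D (\<lambda>A. Re (tr (B * dilation d (F A))))"
    and "(\<integral>A. Re (tr (B * dilation d (F A))) \<partial>D) = 0"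
    by (simp_all add: has_bochner_integral_iff)
qed

definition dil_moment :: "nat \<Rightarrow> nat \<Rightarrow> complex mat \<Rightarrow> real" where
  "dil_moment d m Z = Re (tr (dilation d Z ^\<^sub>m (2 * m)))"

text \<open>The trace of an even power of a self-adjoint matrix is a squared Frobenius norm.
  Nonnegativity lets the moments be handled as \<open>nn_integral\<close>, with no integrability to
  establish for them.\<close>

lemma dil_moment_nonneg: "0 \<le> dil_moment d m Z"
  using fro2_pow[OF dilation_carrier adj_dilation, of d Z m] fro2_nonneg[of "dilation d Z ^\<^sub>m m"]
  by (simp add: dil_moment_def)

lemma measurable_dil_moment:
  assumes "F \<in> measurable M (mat_borel d)"
  shows "(\<lambda>x. dil_moment d m (F x)) \<in> borel_measurable M"
  unfolding dil_moment_def
  by (intro measurable_compose[OF _ borel_measurable_Re] measurable_tr[where d = "d + d"] measurable_mat_pow measurable_mat_dilation assms)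

lemma sum_even_atMost_double:
  "(\<Sum>k\<le>2 * (m :: nat). if even k then f k else 0) = (\<Sum>j\<le>m. f (2 * j) :: real)"
  by (induction m) auto

text \<open>One step with the past frozen as \<open>S\<close>: the Taylor bound is taken at
  \<open>s = 1\<close>. Its even coefficients are constant in \<open>A\<close> and its odd ones
  linear in \<open>F A\<close>, so centring removes exactly the odd ones.\<close>

lemma nn_integral_dil_moment_add_le:
  assumes "prob_space D" and F: "F \<in> measurable D (mat_borel d)"
    and bound: "AE A in D. mat_bound d (F A) \<sigma>" and "0 \<le> \<sigma>"
    and zero: "\<And>i j. i < d \<Longrightarrow> j < d \<Longrightarrow> (\<integral>A. F A $$ (i, j) \<partial>D) = 0"
    and S: "S \<in> carrier_mat d d"
  shows "(\<integral>\<^sup>+A. ennreal (dil_moment d m (S + F A)) \<partial>D)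
    \<le> ennreal (\<Sum>j\<le>m. real (2 * m choose (2 * j)) * \<sigma> ^ (2 * j) * dil_moment d (m - j) S)"
proof -
  interpret prob_space D by fact
  define h where "h k A = taylor_coeff (dilation d S) (dilation d (F A)) \<sigma> (2 * m) k" for k A
  define g where "g A = (\<Sum>k\<le>2 * m. real (2 * m choose k) * h k A)" for A
  have le: "AE A in D. dil_moment d m (S + F A) \<le> g A"
    using bound
  proof eventually_elim
    case (elim A)
    have "dilation d S + complex_of_real 1 \<cdot>\<^sub>m dilation d (F A) = dilation d (S + F A)"
      using elim S by (subst dilation_add) (auto intro!: eq_matI)
    moreover have "Re (tr ((dilation d S + complex_of_real 1 \<cdot>\<^sub>m dilation d (F A)) ^\<^sub>m (2 * m)))
        \<le> (\<Sum>k\<le>2 * m. real (2 * m choose k) * h k A * 1 ^ k)"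
      unfolding h_def
      using mat_bound_dilation[OF elim \<open>0 \<le> \<sigma>\<close>] \<open>0 \<le> \<sigma>\<close>
      by (intro tr_pow_pencil_le[of _ "d + d"]) (auto intro: fro2_mult_le)
    ultimately show ?case by (simp add: dil_moment_def g_def)
  qed
  have h: "has_bochner_integral D (h k) (if even k then \<sigma> ^ k * Re (tr (dilation d S ^\<^sub>m (2 * m - k))) else 0)" for k
  proof (cases "even k")
    case True
    then have "h k = (\<lambda>_. \<sigma> ^ k * Re (tr (dilation d S ^\<^sub>m (2 * m - k))))"
      by (auto simp: h_def taylor_coeff_def)
    then show ?thesis using True by (simp add: has_bochner_integral_iff prob_space)
  next
    case False
    have "dilation d S ^\<^sub>m (2 * m - k) \<in> carrier_mat (d + d) (d + d)" by simp
    note lin = integral_linear_dilation[OF assms(1) F bound zero this]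
    have "h k = (\<lambda>A. \<sigma> ^ (k - 1) * Re (tr (dilation d S ^\<^sub>m (2 * m - k) * dilation d (F A))))"
      using False by (auto simp: h_def taylor_coeff_def)
    then show ?thesis using False lin by (simp add: has_bochner_integral_iff)
  qed
  have "has_bochner_integral D g (\<Sum>k\<le>2 * m. real (2 * m choose k) *
      (if even k then \<sigma> ^ k * Re (tr (dilation d S ^\<^sub>m (2 * m - k))) else 0))"
    unfolding g_def by (intro has_bochner_integral_sum has_bochner_integral_mult_right h)
  also have "(\<Sum>k\<le>2 * m. real (2 * m choose k) *
      (if even k then \<sigma> ^ k * Re (tr (dilation d S ^\<^sub>m (2 * m - k))) else 0))
      = (\<Sum>j\<le>m. real (2 * m choose (2 * j)) * \<sigma> ^ (2 * j) * dil_moment d (m - j) S)"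
    using sum_even_atMost_double[of "\<lambda>k. real (2 * m choose k) * (\<sigma> ^ k * Re (tr (dilation d S ^\<^sub>m (2 * m - k))))" m]
    by (simp add: if_distrib dil_moment_def diff_mult_distrib2 mult.assoc cong: if_cong)
  finally have g: "integrable D g"
    "(\<integral>A. g A \<partial>D) = (\<Sum>j\<le>m. real (2 * m choose (2 * j)) * \<sigma> ^ (2 * j) * dil_moment d (m - j) S)"
    by (simp_all add: has_bochner_integral_iff)
  have "(\<integral>\<^sup>+A. ennreal (dil_moment d m (S + F A)) \<partial>D) \<le> (\<integral>\<^sup>+A. ennreal (g A) \<partial>D)"
    by (intro nn_integral_mono_AE) (use le in \<open>auto intro: ennreal_leI\<close>)
  also have "\<dots> = ennreal (\<integral>A. g A \<partial>D)"
  proof (rule nn_integral_eq_integral[OF g(1)])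
    show "AE A in D. 0 \<le> g A" using le by eventually_elim (use dil_moment_nonneg order_trans in blast)
  qed
  finally show ?thesis unfolding g(2) .
qed

text \<open>The double factorial \<open>(2m - 1)!!\<close>, that is, the moment of order
  \<open>2m\<close> of a standard normal variable.\<close>

definition gauss_moment :: "nat \<Rightarrow> real" where
  "gauss_moment m = fact (2 * m) / (2 ^ m * fact m)"

lemma gauss_moment_nonneg: "0 \<le> gauss_moment m"
  by (simp add: gauss_moment_def)

text \<open>Equivalent to \<open>1 <= gauss_moment j\<close>: the even moments of a random sign do
  not exceed those of a standard normal variable.\<close>

lemma two_power_fact_le: "2 ^ j * fact j \<le> (fact (2 * j) :: real)"
proof (induction j)
  case (Suc j)
  have "2 ^ Suc j * fact (Suc j) = real (2 * Suc j) * (2 ^ j * fact j)" by (simp add: algebra_simps)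
  also have "\<dots> \<le> real (2 * Suc j) * fact (2 * j)" using Suc by (intro mult_left_mono) auto
  also have "\<dots> \<le> real (2 * Suc j) * (real (Suc (2 * j)) * fact (2 * j))"
    by (intro mult_left_mono) auto
  also have "\<dots> = fact (2 * Suc j)" by (simp add: algebra_simps)
  finally show ?case .
qed simp

text \<open>The left side is the moment of order \<open>2m\<close> of a centred normal variable of
  variance \<open>a * b\<close> plus an independent sign of size \<open>sqrt b\<close>. Replacing
  the sign by a normal variable of variance \<open>b\<close> increases each term, by
  \<open>two_power_fact_le\<close>, and variances add, which is the binomial theorem for
  \<open>(a + 1) ^ m\<close>.\<close>

lemma gauss_moment_step:
  assumes "0 \<le> a" "0 \<le> b"
  shows "(\<Sum>j\<le>m. real (2 * m choose (2 * j)) * b ^ j * (gauss_moment (m - j) * (a * b) ^ (m - j)))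
    \<le> gauss_moment m * ((a + 1) * b) ^ m"
proof -
  have "(\<Sum>j\<le>m. real (2 * m choose (2 * j)) * b ^ j * (gauss_moment (m - j) * (a * b) ^ (m - j)))
      \<le> (\<Sum>j\<le>m. gauss_moment m * b ^ m * (real (m choose j) * a ^ (m - j)))"
  proof (intro sum_mono)
    fix j assume "j \<in> {..m}"
    then have j: "j \<le> m" by simp
    have "real (2 * m choose (2 * j)) * gauss_moment (m - j)
        = fact (2 * m) / (fact (2 * j) * 2 ^ (m - j) * fact (m - j))"
      using j by (simp add: binomial_fact gauss_moment_def diff_mult_distrib2)
    also have "\<dots> \<le> fact (2 * m) / (2 ^ j * fact j * 2 ^ (m - j) * fact (m - j))"
      using two_power_fact_le[of j] by (intro divide_left_mono mult_right_mono) auto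
    also have "\<dots> = gauss_moment m * real (m choose j)"
    proof -
      have "(2::real) ^ m = 2 ^ j * 2 ^ (m - j)" using j by (simp flip: power_add)
      then show ?thesis using j by (simp add: binomial_fact gauss_moment_def)
    qed
    finally have "real (2 * m choose (2 * j)) * gauss_moment (m - j) * (b ^ m * a ^ (m - j))
        \<le> gauss_moment m * real (m choose j) * (b ^ m * a ^ (m - j))"
      using assms by (intro mult_right_mono) auto
    moreover have "b ^ m = b ^ j * b ^ (m - j)" using j by (simp flip: power_add)
    ultimately show "real (2 * m choose (2 * j)) * b ^ j * (gauss_moment (m - j) * (a * b) ^ (m - j))
        \<le> gauss_moment m * b ^ m * (real (m choose j) * a ^ (m - j))"
      by (simp add: power_mult_distrib mult_ac)
  qed
  also have "\<dots> = gauss_moment m * b ^ m * (\<Sum>j\<le>m. real (m choose j) * a ^ (m - j))"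
    by (simp add: sum_distrib_left)
  also have "(\<Sum>j\<le>m. real (m choose j) * a ^ (m - j)) = (a + 1) ^ m"
    using binomial_ring[of 1 a m] by (simp add: add.commute)
  finally show ?thesis by (simp add: power_mult_distrib mult_ac)
qed

text \<open>The quotient \<open>(2m)! / m!\<close> has \<open>m\<close> factors, each at most
  \<open>2m\<close>; the powers of 2 cancel.\<close>

lemma gauss_moment_le: "gauss_moment m \<le> real m ^ m"
proof -
  have "(fact (m + k) :: real) \<le> fact m * real (m + k) ^ k" for k
  proof -
    have "fact (m + k) div fact m \<le> (m + k) ^ k"
      using fact_div_fact_le_pow[of k "m + k"] by simp
    moreover have "(fact m :: nat) dvd fact (m + k)" by (intro fact_dvd) simp
    ultimately have "(fact (m + k) :: nat) \<le> fact m * (m + k) ^ k"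
      by (metis dvd_mult_div_cancel mult_le_mono2)
    then have "real (fact (m + k)) \<le> real (fact m * (m + k) ^ k)" by (simp only: of_nat_le_iff)
    then show ?thesis by simp
  qed
  from this[of m] have "fact (2 * m) \<le> fact m * (2 ^ m * real m ^ m)"
    by (simp add: mult_2[symmetric] power_mult_distrib)
  then show ?thesis by (simp add: gauss_moment_def divide_simps mult_ac)
qed

subsection \<open>The Doob martingale of the product\<close>

text \<open>The scale \<open>n\<close> stays fixed while the number \<open>k\<close> of factors
  varies.\<close>

definition partial_prod :: "nat \<Rightarrow> nat \<Rightarrow> nat \<Rightarrow> (nat \<Rightarrow> complex mat) \<Rightarrow> complex mat" where
  "partial_prod d n k X =
     foldr (*) (map (\<lambda>i. 1\<^sub>m d + (1 / of_nat n) \<cdot>\<^sub>m X i) [1..<Suc k]) (1\<^sub>m d)"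

lemma perturb_prod_eq: "perturb_prod d n = partial_prod d n n"
  by (rule ext) (simp only: perturb_prod_def partial_prod_def)

lemma partial_prod_0 [simp]: "partial_prod d n 0 X = 1\<^sub>m d"
  by (simp add: partial_prod_def)

text \<open>Allows the last factor to be split off a right fold: the martingale reveals factors at
  the far end, whereas \<open>foldr\<close> unfolds at the front.\<close>

lemma foldr_mult_mat:
  assumes "\<And>B. B \<in> set Bs \<Longrightarrow> B \<in> carrier_mat d d" "C \<in> carrier_mat d d"
  shows "foldr (*) Bs (1\<^sub>m d) \<in> carrier_mat d d"
    and "foldr (*) Bs C = foldr (*) Bs (1\<^sub>m d) * (C :: complex mat)"
  using assms(1)
proof (induction Bs)
  case (Cons B Bs)
  { case 1 show ?case using 1 Cons.IH(1) by simp }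
  { case 2
    then have "B * foldr (*) Bs C = B * foldr (*) Bs (1\<^sub>m d) * C"
      using Cons.IH assms(2) by (simp add: assoc_mult_mat[of _ d d _ d _ d])
    then show ?case by simp }
qed (use assms(2) in auto)

lemma partial_prod_Suc:
  assumes "\<And>i. i \<in> {1..Suc k} \<Longrightarrow> X i \<in> carrier_mat d d"
  shows "partial_prod d n (Suc k) X = partial_prod d n k X * (1\<^sub>m d + (1 / of_nat n) \<cdot>\<^sub>m X (Suc k))"
proof -
  let ?B = "\<lambda>i. 1\<^sub>m d + (1 / of_nat n) \<cdot>\<^sub>m X i"
  have B: "?B i \<in> carrier_mat d d" if "i \<in> {1..Suc k}" for i using assms[OF that] by simp
  have "[1..<Suc (Suc k)] = [1..<Suc k] @ [Suc k]" by simp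
  then have "partial_prod d n (Suc k) X = foldr (*) (map ?B [1..<Suc k]) (?B (Suc k) * 1\<^sub>m d)"
    unfolding partial_prod_def by simp
  also have "\<dots> = partial_prod d n k X * (?B (Suc k) * 1\<^sub>m d)"
    unfolding partial_prod_def using B B[of "Suc k"]
    by (intro foldr_mult_mat(2)) (auto simp del: upt_Suc)
  finally show ?thesis using right_mult_one_mat[OF B, of "Suc k"] by simp
qed

lemma partial_prod_carrier:
  assumes "\<And>i. i \<in> {1..k} \<Longrightarrow> X i \<in> carrier_mat d d"
  shows "partial_prod d n k X \<in> carrier_mat d d"
  unfolding partial_prod_def using assms
  by (intro foldr_mult_mat(1)[where C = "1\<^sub>m d"]) (auto simp del: upt_Suc)

lemma partial_prod_cong:
  assumes "\<And>i. i \<in> {1..k} \<Longrightarrow> X i = Y i"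
  shows "partial_prod d n k X = partial_prod d n k Y"
  unfolding partial_prod_def using assms
  by (intro arg_cong2[where f = "foldr (*)"] map_cong refl) (auto simp del: upt_Suc)

lemma mat_bound_one_plus:
  assumes "mat_bound d A L"
  shows "mat_bound d (1\<^sub>m d + (1 / of_nat n) \<cdot>\<^sub>m A) (1 + L / real n)"
  using mat_bound_add[OF mat_bound_one mat_bound_smult[OF assms, of "1 / of_nat n"]]
  by (simp add: norm_divide)

lemma mat_bound_partial_prod:
  assumes "\<And>i. i \<in> {1..k} \<Longrightarrow> mat_bound d (X i) L" "0 \<le> L"
  shows "mat_bound d (partial_prod d n k X) ((1 + L / real n) ^ k)"
  using assms(1)
proof (induction k)
  case 0
  show ?case using mat_bound_one by simp
next
  case (Suc k)
  have "mat_bound d (partial_prod d n k X) ((1 + L / real n) ^ k)" using Suc by auto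
  moreover have "mat_bound d (1\<^sub>m d + (1 / of_nat n) \<cdot>\<^sub>m X (Suc k)) (1 + L / real n)"
    using Suc by (intro mat_bound_one_plus) auto
  moreover have "partial_prod d n (Suc k) X = partial_prod d n k X * (1\<^sub>m d + (1 / of_nat n) \<cdot>\<^sub>m X (Suc k))"
    using Suc.prems by (intro partial_prod_Suc) blast
  moreover have "0 \<le> (1 + L / real n) ^ k" using assms(2) by simp
  ultimately show ?case by (simp only: power_Suc2 mat_bound_mult)
qed

lemma one_plus_pow_le_exp:
  assumes "0 \<le> L" "k \<le> n"
  shows "(1 + L / real n) ^ k \<le> exp L"
proof (cases "n = 0")
  case False
  have "(1 + L / real n) ^ k \<le> (1 + L / real n) ^ n" using assms by (intro power_increasing) auto
  also have "\<dots> \<le> exp L" using False assms by (intro exp_ge_one_plus_x_over_n_power_n) auto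
  finally show ?thesis .
qed (use assms in auto)

lemma add_minus_right_comm:
  fixes A :: "complex mat"
  assumes "A \<in> carrier_mat n m" "B \<in> carrier_mat n m" "C \<in> carrier_mat n m"
  shows "A + B - C = A - C + B"
  using assms by (intro eq_matI) auto

lemma minus_minus_minus_mat:
  fixes A :: "complex mat"
  assumes "A \<in> carrier_mat n m" "B \<in> carrier_mat n m" "C \<in> carrier_mat n m"
  shows "A - B - (C - B) = A - C"
  using assms by (intro eq_matI) auto

lemma sum_ennreal_mult:
  assumes "\<And>j. 0 \<le> a j" "\<And>j. 0 \<le> b j"
  shows "(\<Sum>j\<in>J. ennreal (a j) * ennreal (b j)) = ennreal (\<Sum>j\<in>J. a j * b j)"
proof -
  have "(\<Sum>j\<in>J. ennreal (a j) * ennreal (b j)) = (\<Sum>j\<in>J. ennreal (a j * b j))"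
    using assms by (intro sum.cong refl) (simp add: ennreal_mult)
  also have "\<dots> = ennreal (\<Sum>j\<in>J. a j * b j)"
    using assms by (intro sum_ennreal) simp
  finally show ?thesis .
qed

section \<open>The martingale under a fixed law \<open>D\<close> with mean
  \<open>\<mu>\<close>\<close>

context
  fixes n d :: nat and L :: real and D :: "complex mat measure" and \<mu> :: "complex mat"
  assumes n: "1 \<le> n" and L: "0 < L" and prob: "prob_space D"
    and sets: "sets D = sets (mat_borel d)" and mean: "mat_expectation d D = \<mu>"
    and bound: "AE A in D. op_norm A \<le> L"
begin

lemma space_law: "space D = carrier_mat d d"
  using sets_eq_imp_space_eq[OF sets] by simp

lemma AE_mat_bound: "AE A in D. mat_bound d A L"
  using bound AE_space
  by eventually_elim (use L in \<open>simp add: space_law op_norm_le_iff\<close>)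

lemma measurable_law_id: "(\<lambda>A. A) \<in> measurable D (mat_borel d)"
  by (rule measurable_ident_sets[OF sets])

lemma mean_carrier: "\<mu> \<in> carrier_mat d d"
  using mean by (auto simp: mat_expectation_def)

lemma has_bochner_integral_mean:
  "i < d \<Longrightarrow> j < d \<Longrightarrow> has_bochner_integral D (\<lambda>A. A $$ (i, j)) (\<mu> $$ (i, j))"
  using integrable_mat_index[OF prob measurable_law_id AE_mat_bound] mean
  by (auto simp: has_bochner_integral_iff mat_expectation_def)

text \<open>Jensen's inequality by duality, as the mean is entrywise: for
  \<open>w = \<mu> v\<close>, the number \<open>norm w ^ 2\<close> is the integral of
  \<open><w, A v>\<close>, which is at most \<open>norm w * L * norm v\<close> almost
  everywhere.\<close>

lemma mat_bound_mean: "mat_bound d \<mu> L"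
  unfolding mat_bound_def
proof (intro conjI ballI mean_carrier)
  interpret prob_space D by (rule prob)
  fix v :: "complex vec" assume v: "v \<in> carrier_vec d"
  define w where "w = \<mu> *\<^sub>v v"
  have w: "w \<in> carrier_vec d" using mean_carrier v by (simp add: w_def)
  define f where "f A = (\<Sum>i<d. cnj (vec_index w i) * (\<Sum>j<d. A $$ (i, j) * vec_index v j))" for A :: "complex mat"
  have "has_bochner_integral D f (f \<mu>)"
    unfolding f_def
    by (intro has_bochner_integral_sum has_bochner_integral_mult_right has_bochner_integral_mult_left
        has_bochner_integral_mean) auto
  then have f: "integrable D f" "(\<integral>A. f A \<partial>D) = f \<mu>" by (auto simp: has_bochner_integral_iff)
  have f_eq: "f A = (\<Sum>i<d. cnj (vec_index w i) * vec_index (A *\<^sub>v v) i)" if "A \<in> carrier_mat d d" for A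
    using that v by (simp add: f_def mult_vec_index[of _ d d] del: index_mult_mat_vec)
  have "complex_of_real ((l2_norm w)\<^sup>2) = f \<mu>"
    using f_eq[OF mean_carrier] l2_norm_sq_inner[OF w] by (simp add: w_def)
  then have "(l2_norm w)\<^sup>2 = cmod (\<integral>A. f A \<partial>D)"
    unfolding f(2) by (metis abs_of_nonneg norm_of_real zero_le_power2)
  also have "\<dots> \<le> (\<integral>A. cmod (f A) \<partial>D)" by (rule integral_norm_bound)
  also have "\<dots> \<le> (\<integral>A. l2_norm w * (L * l2_norm v) \<partial>D)"
  proof (rule integral_mono_AE)
    show "AE A in D. cmod (f A) \<le> l2_norm w * (L * l2_norm v)"
      using AE_mat_bound
    proof eventually_elim
      case (elim A)
      then have A: "A \<in> carrier_mat d d" by auto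
      have "cmod (f A) \<le> l2_norm w * l2_norm (A *\<^sub>v v)"
        unfolding f_eq[OF A] using A w v by (intro l2_inner_le) auto
      also have "\<dots> \<le> l2_norm w * (L * l2_norm v)"
        using elim v by (intro mult_left_mono mat_boundD) auto
      finally show ?case .
    qed
  qed (use f in auto)
  also have "\<dots> = l2_norm w * (L * l2_norm v)" by (simp add: prob_space)
  finally have "l2_norm w * l2_norm w \<le> l2_norm w * (L * l2_norm v)" by (simp add: power2_eq_square)
  then show "l2_norm (\<mu> *\<^sub>v v) \<le> L * l2_norm v"
    using L l2_norm_nonneg[of w] unfolding w_def[symmetric]
    by (cases "l2_norm w = 0") auto
qed

definition "mean_factor = 1\<^sub>m d + (1 / of_nat n) \<cdot>\<^sub>m \<mu>"

text \<open>The Doob martingale of the product: conditioning on \<open>X\<^sub>1, \<dots>, X\<^sub>k\<close> replaces the remaining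
  factors by \<open>mean_factor\<close>.\<close>

definition "doob k X = partial_prod d n k X * mean_factor ^\<^sub>m (n - k) - mean_factor ^\<^sub>m n"

definition "doob_incr k X A = partial_prod d n k X * ((1 / of_nat n) \<cdot>\<^sub>m (A - \<mu>)) * mean_factor ^\<^sub>m (n - Suc k)"

text \<open>The centred matrix \<open>A - \<mu>\<close> has norm at most \<open>2 * L\<close>; the
  other \<open>n - 1\<close> factors of an increment, each of norm at most \<open>1 + L / n\<close>,
  together contribute at most \<open>exp L\<close>.\<close>

definition "step_bound = 2 * L * exp L / real n"

lemma mean_factor_carrier [simp]: "mean_factor \<in> carrier_mat d d"
  using mean_carrier by (simp add: mean_factor_def)

lemma doob_0: "doob 0 X = 0\<^sub>m d d"
proof -
  have "mean_factor ^\<^sub>m n \<in> carrier_mat d d" by simp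
  then have "1\<^sub>m d * mean_factor ^\<^sub>m n = mean_factor ^\<^sub>m n" "mean_factor ^\<^sub>m n - mean_factor ^\<^sub>m n = 0\<^sub>m d d"
    by (rule left_mult_one_mat, rule minus_r_inv_mat)
  then show ?thesis by (simp add: doob_def)
qed

text \<open>Revealing \<open>A\<close> takes one \<open>mean_factor\<close> off the tail and puts
  \<open>I + A / n = mean_factor + (A - \<mu>) / n\<close> in its place; the first summand restores
  the old value.\<close>

lemma doob_Suc:
  assumes "k < n" and X: "\<And>i. i \<in> {1..k} \<Longrightarrow> X i \<in> carrier_mat d d" and A: "A \<in> carrier_mat d d"
  shows "doob (Suc k) (X(Suc k := A)) = doob k X + doob_incr k X A"
proof -
  define P R G where "P = partial_prod d n k X" and "R = mean_factor ^\<^sub>m (n - Suc k)"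
    and "G = (1 / of_nat n) \<cdot>\<^sub>m (A - \<mu>)"
  have c: "P \<in> carrier_mat d d" "R \<in> carrier_mat d d" "G \<in> carrier_mat d d" "mean_factor ^\<^sub>m n \<in> carrier_mat d d"
    using partial_prod_carrier[OF X] A mean_carrier by (auto simp: P_def R_def G_def)
  have QG: "1\<^sub>m d + (1 / of_nat n) \<cdot>\<^sub>m A = mean_factor + G"
    using A mean_carrier by (intro eq_matI) (auto simp: mean_factor_def G_def algebra_simps)
  have nk: "n - k = Suc (n - Suc k)" using assms(1) by simp
  have QR: "mean_factor ^\<^sub>m (n - k) = mean_factor * R"
    unfolding R_def nk by (rule pow_mat_Suc_left[OF mean_factor_carrier])
  have "partial_prod d n (Suc k) (X(Suc k := A))
      = partial_prod d n k (X(Suc k := A)) * (1\<^sub>m d + (1 / of_nat n) \<cdot>\<^sub>m (X(Suc k := A)) (Suc k))"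
    using X A by (intro partial_prod_Suc) auto
  also have "partial_prod d n k (X(Suc k := A)) = P"
    unfolding P_def by (rule partial_prod_cong) auto
  finally have step: "partial_prod d n (Suc k) (X(Suc k := A)) = P * (mean_factor + G)"
    by (simp only: fun_upd_same QG)
  have "doob (Suc k) (X(Suc k := A)) = P * (mean_factor + G) * R - mean_factor ^\<^sub>m n"
    by (simp only: doob_def step R_def)
  also have "P * (mean_factor + G) * R = P * (mean_factor * R) + P * G * R"
    using c by (simp add: mult_add_distrib_mat[of _ d d _ d] add_mult_distrib_mat[of _ d d _ _ d]
        assoc_mult_mat[of _ d d _ d _ d])
  also have "P * (mean_factor * R) + P * G * R - mean_factor ^\<^sub>m n = (P * (mean_factor * R) - mean_factor ^\<^sub>m n) + P * G * R"
    using c by (intro add_minus_right_comm) auto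
  finally show ?thesis by (simp only: doob_def[of k] doob_incr_def QR P_def R_def G_def)
qed

lemma mat_bound_incr:
  assumes "k < n" and X: "\<And>i. i \<in> {1..k} \<Longrightarrow> mat_bound d (X i) L" and A: "mat_bound d A L"
  shows "mat_bound d (doob_incr k X A) step_bound"
proof -
  define x where "x = 1 + L / real n"
  have x: "0 \<le> x" using L by (simp add: x_def)
  have "mat_bound d (doob_incr k X A) (x ^ k * (cmod (1 / of_nat n) * (L + L)) * x ^ (n - Suc k))"
    unfolding doob_incr_def x_def using L x unfolding x_def
    by (intro mat_bound_mult mat_bound_partial_prod mat_bound_smult mat_bound_minus A X
        mat_bound_mean mat_bound_pow) (auto simp: mean_factor_def intro!: mat_bound_one_plus mat_bound_mean)
  moreover have "x ^ k * (cmod (1 / of_nat n) * (L + L)) * x ^ (n - Suc k) = 2 * L / real n * x ^ (n - 1)"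
  proof -
    have "x ^ (n - 1) = x ^ k * x ^ (n - Suc k)" using assms(1) by (simp flip: power_add)
    then show ?thesis by (simp add: norm_divide)
  qed
  moreover have "2 * L / real n * x ^ (n - 1) \<le> 2 * L / real n * exp L"
    unfolding x_def using L by (intro mult_left_mono one_plus_pow_le_exp) auto
  ultimately show ?thesis using mat_bound_mono by (simp add: step_bound_def)
qed

lemma measurable_incr:
  assumes X: "\<And>i. i \<in> {1..k} \<Longrightarrow> X i \<in> carrier_mat d d"
  shows "doob_incr k X \<in> measurable D (mat_borel d)"
  unfolding doob_incr_def
  by (intro measurable_mat_mult measurable_mat_smult measurable_mat_minus measurable_law_id
      measurable_mat_const mean_carrier partial_prod_carrier X) simp_all

lemma integral_incr:
  assumes X: "\<And>i. i \<in> {1..k} \<Longrightarrow> X i \<in> carrier_mat d d" and ij: "i < d" "j < d"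
  shows "(\<integral>A. doob_incr k X A $$ (i, j) \<partial>D) = 0"
proof -
  define P R where "P = partial_prod d n k X" and "R = mean_factor ^\<^sub>m (n - Suc k)"
  have c: "P \<in> carrier_mat d d" "R \<in> carrier_mat d d"
    using partial_prod_carrier[OF X] by (auto simp: P_def R_def)
  interpret prob_space D by (rule prob)
  have "has_bochner_integral D
      (\<lambda>A. \<Sum>l<d. (\<Sum>p<d. P $$ (i, p) * (1 / of_nat n * (A $$ (p, l) - \<mu> $$ (p, l)))) * R $$ (l, j))
      (\<Sum>l<d. (\<Sum>p<d. P $$ (i, p) * (1 / of_nat n * (\<mu> $$ (p, l) - \<mu> $$ (p, l)))) * R $$ (l, j))"
    by (intro has_bochner_integral_sum has_bochner_integral_mult_right has_bochner_integral_mult_left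
        has_bochner_integral_diff has_bochner_integral_mean)
      (auto simp: has_bochner_integral_iff prob_space)
  then have "(\<integral>A. (\<Sum>l<d. (\<Sum>p<d. P $$ (i, p) * (1 / of_nat n * (A $$ (p, l) - \<mu> $$ (p, l)))) * R $$ (l, j)) \<partial>D) = 0"
    by (simp add: has_bochner_integral_iff)
  also have "?this \<longleftrightarrow> ?thesis"
  proof (intro arg_cong2[where f = "(=)"] Bochner_Integration.integral_cong refl)
    fix A assume "A \<in> space D"
    then have A: "A \<in> carrier_mat d d" by (simp add: space_law)
    let ?G = "(1 / of_nat n) \<cdot>\<^sub>m (A - \<mu>)"
    have G: "?G \<in> carrier_mat d d" using mean_carrier by (intro smult_carrier_mat minus_carrier_mat)
    have "doob_incr k X A $$ (i, j) = (\<Sum>l<d. (P * ?G) $$ (i, l) * R $$ (l, j))"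
      unfolding doob_incr_def P_def[symmetric] R_def[symmetric]
      using c G ij by (intro mult_index) auto
    also have "\<dots> = (\<Sum>l<d. (\<Sum>p<d. P $$ (i, p) * (1 / of_nat n * (A $$ (p, l) - \<mu> $$ (p, l)))) * R $$ (l, j))"
    proof (intro sum.cong refl)
      fix l assume "l \<in> {..<d}"
      then have "(P * ?G) $$ (i, l) = (\<Sum>p<d. P $$ (i, p) * ?G $$ (p, l))"
        using c G ij by (intro mult_index) auto
      also have "\<dots> = (\<Sum>p<d. P $$ (i, p) * (1 / of_nat n * (A $$ (p, l) - \<mu> $$ (p, l))))"
        using A mean_carrier \<open>l \<in> {..<d}\<close> by (intro sum.cong refl) auto
      finally show "(P * ?G) $$ (i, l) * R $$ (l, j)
          = (\<Sum>p<d. P $$ (i, p) * (1 / of_nat n * (A $$ (p, l) - \<mu> $$ (p, l)))) * R $$ (l, j)" by simp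
    qed
    finally show "(\<Sum>l<d. (\<Sum>p<d. P $$ (i, p) * (1 / of_nat n * (A $$ (p, l) - \<mu> $$ (p, l)))) * R $$ (l, j))
        = doob_incr k X A $$ (i, j)" ..
  qed
  finally show ?thesis .
qed

text \<open>The index set \<open>I\<close> is free because the induction views a product of
  \<open>k\<close> factors on a space with further coordinates.\<close>

lemma measurable_partial_prod:
  "{1..k} \<subseteq> I \<Longrightarrow> partial_prod d n k \<in> measurable (PiM I (\<lambda>_. D)) (mat_borel d)"
proof (induction k)
  case 0
  have "(\<lambda>X. 1\<^sub>m d) \<in> measurable (PiM I (\<lambda>_. D)) (mat_borel d)"
    by (intro measurable_mat_const) simp
  then show ?case by simp
next
  case (Suc k)
  have comp: "(\<lambda>X. X i) \<in> measurable (PiM I (\<lambda>_. D)) (mat_borel d)" if "i \<in> {1..Suc k}" for i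
    using measurable_compose[OF measurable_component_singleton[of i I "\<lambda>_. D"] measurable_law_id] that Suc.prems
    by auto
  have "{1..k} \<subseteq> I" using Suc.prems by auto
  then have "(\<lambda>X. partial_prod d n k X * (1\<^sub>m d + (1 / of_nat n) \<cdot>\<^sub>m X (Suc k)))
      \<in> measurable (PiM I (\<lambda>_. D)) (mat_borel d)"
    by (intro measurable_mat_mult measurable_mat_add measurable_mat_smult measurable_mat_const comp Suc.IH) auto
  also have "?this \<longleftrightarrow> ?case"
    using measurable_mat_carrier[OF comp]
    by (intro measurable_cong partial_prod_Suc[symmetric]) blast
  finally show ?case .
qed

lemma measurable_doob:
  "{1..k} \<subseteq> I \<Longrightarrow> doob k \<in> measurable (PiM I (\<lambda>_. D)) (mat_borel d)"
  unfolding doob_def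
  by (intro measurable_mat_minus measurable_mat_mult measurable_mat_const measurable_partial_prod) simp_all

text \<open>Fubini separates the last coordinate, the one-step bound is applied for almost every
  past, and \<open>gauss_moment_step\<close> advances the variance from \<open>k\<close> to
  \<open>Suc k\<close> steps. The lower moments occurring there require \<open>m\<close> to be
  arbitrary.\<close>

lemma doob_moment_le:
  assumes "k \<le> n"
  shows "(\<integral>\<^sup>+X. ennreal (dil_moment d m (doob k X)) \<partial>PiM {1..k} (\<lambda>_. D))
    \<le> ennreal (2 * real d * (gauss_moment m * (real k * step_bound\<^sup>2) ^ m))"
  using assms
proof (induction k arbitrary: m)
  case 0
  interpret P: prob_space "PiM {} (\<lambda>_::nat. D)" by (intro prob_space_PiM prob)
  have dil0: "dilation d (0\<^sub>m d d) = 0\<^sub>m (d + d) (d + d)"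
    by (intro eq_matI) (auto simp: dilation_def)
  \<comment> \<open>For \<open>m = 0\<close> this is the trace \<open>2 d\<close> of the identity,
    matched by \<open>0 ^ 0 = 1\<close>; all higher moments vanish.\<close>
  have "dil_moment d m (0\<^sub>m d d) = 2 * real d * (gauss_moment m * 0 ^ m)"
  proof (cases m)
    case 0
    then show ?thesis by (simp add: dil_moment_def tr_def gauss_moment_def dilation_def)
  next
    case (Suc m')
    have "0\<^sub>m (d + d) (d + d) ^\<^sub>m Suc k * (0\<^sub>m (d + d) (d + d)) = (0\<^sub>m (d + d) (d + d) :: complex mat)" for k
      by (rule right_mult_zero_mat[OF pow_carrier_mat]) simp
    then show ?thesis using Suc by (simp add: dil_moment_def dil0 tr_def)
  qed
  then show ?case by (simp add: doob_0 P.emeasure_space_1)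
next
  case (Suc k)
  let ?P = "\<lambda>I. PiM I (\<lambda>_::nat. D)"
  interpret product_sigma_finite "\<lambda>_::nat. D"
    by (intro product_sigma_finite.intro prob_space_imp_sigma_finite prob)
  have ins: "{1..Suc k} = insert (Suc k) {1..k}" by auto
  define c where "c j = real (2 * m choose (2 * j)) * step_bound ^ (2 * j)" for j
  have c: "0 \<le> c j" for j by (simp add: c_def power_mult)
  have AEX: "AE X in ?P {1..k}. \<forall>i\<in>{1..k}. mat_bound d (X i) L"
    by (intro AE_finite_allI AE_PiM_component prob AE_mat_bound) auto
  have "(\<integral>\<^sup>+X. ennreal (dil_moment d m (doob (Suc k) X)) \<partial>?P {1..Suc k})
      = (\<integral>\<^sup>+X. \<integral>\<^sup>+A. ennreal (dil_moment d m (doob (Suc k) (X(Suc k := A)))) \<partial>D \<partial>?P {1..k})"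
    unfolding ins
    by (intro product_nn_integral_insert measurable_compose[OF _ measurable_ennreal]
        measurable_dil_moment measurable_doob) auto
  also have "\<dots> \<le> (\<integral>\<^sup>+X. (\<Sum>j\<le>m. ennreal (c j) * ennreal (dil_moment d (m - j) (doob k X))) \<partial>?P {1..k})"
  proof (intro nn_integral_mono_AE)
    show "AE X in ?P {1..k}. (\<integral>\<^sup>+A. ennreal (dil_moment d m (doob (Suc k) (X(Suc k := A)))) \<partial>D)
        \<le> (\<Sum>j\<le>m. ennreal (c j) * ennreal (dil_moment d (m - j) (doob k X)))"
      using AEX
    proof eventually_elim
      case (elim X)
      have Xb: "mat_bound d (X i) L" if "i \<in> {1..k}" for i using elim that by blast
      then have Xc: "X i \<in> carrier_mat d d" if "i \<in> {1..k}" for i using that by blast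
      have doob_c: "doob k X \<in> carrier_mat d d"
        using partial_prod_carrier[OF Xc] by (simp add: doob_def minus_carrier_mat)
      have kn: "k < n" using Suc.prems by simp
      have "(\<integral>\<^sup>+A. ennreal (dil_moment d m (doob (Suc k) (X(Suc k := A)))) \<partial>D)
          = (\<integral>\<^sup>+A. ennreal (dil_moment d m (doob k X + doob_incr k X A)) \<partial>D)"
        by (intro nn_integral_cong arg_cong[where f = ennreal] arg_cong[where f = "dil_moment d m"]
            doob_Suc[OF kn Xc]) (auto simp: space_law)
      also have "\<dots> \<le> ennreal (\<Sum>j\<le>m. c j * dil_moment d (m - j) (doob k X))"
        unfolding c_def
      proof (rule nn_integral_dil_moment_add_le[OF prob measurable_incr[OF Xc] _ _ integral_incr[OF Xc] doob_c])
        show "AE A in D. mat_bound d (doob_incr k X A) step_bound"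
          using AE_mat_bound by eventually_elim (rule mat_bound_incr[OF kn Xb])
        show "0 \<le> step_bound" using L by (simp add: step_bound_def)
      qed
      also have "\<dots> = (\<Sum>j\<le>m. ennreal (c j) * ennreal (dil_moment d (m - j) (doob k X)))"
        by (intro sum_ennreal_mult[symmetric] c dil_moment_nonneg)
      finally show ?case .
    qed
  qed
  also have "\<dots> = (\<Sum>j\<le>m. ennreal (c j) * (\<integral>\<^sup>+X. ennreal (dil_moment d (m - j) (doob k X)) \<partial>?P {1..k}))"
  proof -
    have meas: "(\<lambda>X. ennreal (dil_moment d (m - j) (doob k X))) \<in> borel_measurable (?P {1..k})" for j
      by (intro measurable_compose[OF _ measurable_ennreal] measurable_dil_moment measurable_doob) auto
    have "(\<lambda>X. ennreal (c j) * ennreal (dil_moment d (m - j) (doob k X))) \<in> borel_measurable (?P {1..k})" for j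
      using meas[of j] by measurable
    then show ?thesis by (simp only: nn_integral_sum nn_integral_cmult[OF meas])
  qed
  also have "\<dots> \<le> (\<Sum>j\<le>m. ennreal (c j) * ennreal (2 * real d * (gauss_moment (m - j) * (real k * step_bound\<^sup>2) ^ (m - j))))"
    using Suc.prems by (intro sum_mono mult_left_mono Suc.IH) simp_all
  also have "\<dots> = ennreal (\<Sum>j\<le>m. c j * (2 * real d * (gauss_moment (m - j) * (real k * step_bound\<^sup>2) ^ (m - j))))"
    using gauss_moment_nonneg by (intro sum_ennreal_mult c) simp
  also have "\<dots> \<le> ennreal (2 * real d * (gauss_moment m * (real (Suc k) * step_bound\<^sup>2) ^ m))"
  proof (rule ennreal_leI)
    have "(\<Sum>j\<le>m. c j * (2 * real d * (gauss_moment (m - j) * (real k * step_bound\<^sup>2) ^ (m - j))))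
        = 2 * real d * (\<Sum>j\<le>m. real (2 * m choose (2 * j)) * (step_bound\<^sup>2) ^ j * (gauss_moment (m - j) * (real k * step_bound\<^sup>2) ^ (m - j)))"
      unfolding sum_distrib_left by (intro sum.cong refl) (simp add: c_def power_mult)
    also have "\<dots> \<le> 2 * real d * (gauss_moment m * ((real k + 1) * step_bound\<^sup>2) ^ m)"
      by (intro mult_left_mono gauss_moment_step) simp_all
    finally show "(\<Sum>j\<le>m. c j * (2 * real d * (gauss_moment (m - j) * (real k * step_bound\<^sup>2) ^ (m - j))))
        \<le> 2 * real d * (gauss_moment m * (real (Suc k) * step_bound\<^sup>2) ^ m)" by (simp add: add.commute)
  qed
  finally show ?case .
qed

text \<open>Markov's inequality for the power \<open>2 * 2 ^ p\<close>. Bounding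
  \<open>gauss_moment m\<close> by \<open>m ^ m\<close> turns the right-hand side into a pure
  \<open>m\<close>-th power, whose base can then be made small.\<close>

lemma doob_tail:
  assumes "0 < \<tau>"
  shows "measure (iid_law n D) {X \<in> space (iid_law n D). \<not> op_norm (doob n X) \<le> \<tau>}
    \<le> 2 * real d * (2 ^ p * real n * step_bound\<^sup>2 / \<tau>\<^sup>2) ^ 2 ^ p"
proof -
  let ?P = "PiM {1..n} (\<lambda>_. D)"
  interpret P: prob_space ?P by (intro prob_space_PiM prob)
  define m :: nat where "m = 2 ^ p"
  define B where "B = {X \<in> space ?P. \<not> op_norm (doob n X) \<le> \<tau>}"
  define K where "K = 2 * real d * (gauss_moment m * (real n * step_bound\<^sup>2) ^ m)"
  have K: "0 \<le> K" using gauss_moment_nonneg by (simp add: K_def)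
  have doob: "doob n \<in> measurable ?P (mat_borel d)" by (rule measurable_doob) simp
  have "B = space ?P - {X \<in> space ?P. op_norm (doob n X) \<le> \<tau>}" by (auto simp: B_def)
  then have B: "B \<in> sets ?P" using measurable_op_norm_le[OF doob, of \<tau>] by auto
  have "ennreal (\<tau> ^ (2 * m)) * emeasure ?P B = (\<integral>\<^sup>+X. ennreal (\<tau> ^ (2 * m)) * indicator B X \<partial>?P)"
    using B by (simp add: nn_integral_cmult_indicator)
  also have "\<dots> \<le> (\<integral>\<^sup>+X. ennreal (dil_moment d m (doob n X)) \<partial>?P)"
  proof (intro nn_integral_mono)
    fix X assume X: "X \<in> space ?P"
    have "\<tau> ^ (2 * m) \<le> dil_moment d m (doob n X)" if "X \<in> B"
    proof -
      have "\<tau> ^ (2 * m) \<le> op_norm (doob n X) ^ (2 * m)"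
        using that assms by (intro power_mono) (auto simp: B_def)
      also have "\<dots> \<le> dil_moment d m (doob n X)"
        unfolding dil_moment_def m_def
        by (rule op_norm_pow_le_tr_dilation[OF measurable_mat_carrier[OF doob X]])
      finally show ?thesis .
    qed
    then show "ennreal (\<tau> ^ (2 * m)) * indicator B X \<le> ennreal (dil_moment d m (doob n X))"
      by (auto split: split_indicator intro: ennreal_leI)
  qed
  also have "\<dots> \<le> ennreal K" unfolding K_def by (rule doob_moment_le) simp
  finally have "ennreal (\<tau> ^ (2 * m) * measure ?P B) \<le> ennreal K"
    using assms by (simp only: ennreal_mult P.emeasure_eq_measure measure_nonneg zero_le_power less_imp_le)
  then have "\<tau> ^ (2 * m) * measure ?P B \<le> K" using K by (simp add: ennreal_le_iff)
  then have "measure ?P B \<le> K / \<tau> ^ (2 * m)" using assms by (simp add: field_simps)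
  also have "\<dots> \<le> 2 * real d * (real m ^ m * (real n * step_bound\<^sup>2) ^ m) / \<tau> ^ (2 * m)"
    unfolding K_def using assms gauss_moment_le[of m]
    by (intro divide_right_mono mult_left_mono mult_right_mono) auto
  also have "\<dots> = 2 * real d * (2 ^ p * real n * step_bound\<^sup>2 / \<tau>\<^sup>2) ^ m"
    by (simp add: m_def power_mult power_mult_distrib power_divide mult.assoc)
  finally show ?thesis by (simp add: B_def iid_law_def m_def)
qed

text \<open>For \<open>d = 1\<close> and \<open>\<delta>\<close> near 1 the radius tends to 0, while
  the law concentrated at \<open>L\<close> keeps the bias \<open>exp L - (1 + L / n) ^ n\<close>.
  The alternative in the hypothesis excludes this by forcing \<open>d / \<delta> >= 2\<close>. Of
  the constant 30, the martingale takes 27 and the bias 3.\<close>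

lemma deviation_high_prob:
  assumes \<delta>: "0 < \<delta>" "\<delta> < 1" "2 \<le> d \<or> \<delta> \<le> 1 / 2" and d: "1 \<le> d"
  shows "measure (iid_law n D) {X \<in> space (iid_law n D). op_norm (perturb_prod d n X - mat_exp \<mu>)
    \<le> 30 * L * exp L / sqrt (real n) * sqrt (ln (real d / \<delta>))} > 1 - \<delta>"
proof -
  let ?P = "iid_law n D"
  interpret P: prob_space ?P unfolding iid_law_def by (intro prob_space_PiM prob)
  define l where "l = ln (real d / \<delta>)"
  define K where "K = L * exp L / sqrt (real n)"
  define R where "R = 30 * L * exp L / sqrt (real n) * sqrt l"
  have R: "R = 30 * K * sqrt l" by (simp add: R_def K_def)
  have K: "0 < K" using L n by (simp add: K_def)
  have d\<delta>: "2 \<le> real d / \<delta>"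
  proof (cases "2 \<le> d")
    case True
    then show ?thesis using \<delta> by (simp add: field_simps)
  next
    case False
    then show ?thesis using \<delta> d by (simp add: field_simps)
  qed
  have l: "1 / 2 \<le> l"
  proof -
    have "(exp (1 / 2 :: real))\<^sup>2 \<le> 2\<^sup>2"
      using exp_le exp_double[of "1 / 2 :: real"] by simp
    then have "exp (1 / 2 :: real) \<le> 2" by (rule power2_le_imp_le) simp
    then have "1 / 2 \<le> ln (2 :: real)" by (subst ln_ge_iff) simp_all
    also have "\<dots> \<le> l" unfolding l_def using d\<delta> by simp
    finally show ?thesis .
  qed
  \<comment> \<open>Bounds \<open>K\<close> by a multiple of \<open>K * sqrt l\<close>, which lets
    the radius absorb the terms without a logarithm.\<close>
  have sl: "1 / 2 \<le> sqrt l"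
    using l by (intro real_le_rsqrt) (simp add: power2_eq_square)
  have carrier: "perturb_prod d n X \<in> carrier_mat d d" and doob_eq: "doob n X = perturb_prod d n X - mean_factor ^\<^sub>m n"
    if "\<And>i. i \<in> {1..n} \<Longrightarrow> X i \<in> carrier_mat d d" for X
  proof -
    show "perturb_prod d n X \<in> carrier_mat d d"
      using partial_prod_carrier[OF that] by (simp add: perturb_prod_eq)
    then show "doob n X = perturb_prod d n X - mean_factor ^\<^sub>m n"
      using carrier_matD[OF mean_factor_carrier] by (simp add: doob_def perturb_prod_eq)
  qed
  have meas: "(\<lambda>X. perturb_prod d n X - mat_exp \<mu>) \<in> measurable ?P (mat_borel d)"
    unfolding perturb_prod_eq iid_law_def
    by (intro measurable_mat_minus measurable_partial_prod mat_exp_carrier mean_carrier) simp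
  define G where "G = {X \<in> space ?P. op_norm (perturb_prod d n X - mat_exp \<mu>) \<le> R}"
  have G: "G \<in> sets ?P" unfolding G_def by (rule measurable_op_norm_le[OF meas])
  have Xc: "X i \<in> carrier_mat d d" if "X \<in> space ?P" "i \<in> {1..n}" for X i
    using that by (auto simp: iid_law_def space_PiM space_law)
  have "1 - \<delta> < measure ?P G"
  proof (cases "L \<le> sqrt (real n)")
    case False
    have AEX: "AE X in ?P. \<forall>i\<in>{1..n}. mat_bound d (X i) L"
      unfolding iid_law_def by (intro AE_finite_allI AE_PiM_component prob AE_mat_bound) auto
    have "AE X in ?P. X \<in> G"
      using AEX AE_space
    proof eventually_elim
      case (elim X)
      have "mat_bound d (partial_prod d n n X) ((1 + L / real n) ^ n)"
        using elim L by (intro mat_bound_partial_prod) auto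
      then have "mat_bound d (perturb_prod d n X) (exp L)"
        using one_plus_pow_le_exp[of L n n] L
        by (auto simp: perturb_prod_eq intro: mat_bound_mono)
      then have "mat_bound d (perturb_prod d n X - mat_exp \<mu>) (exp L + exp L)"
        using L by (intro mat_bound_minus mat_bound_mat_exp mat_bound_mean) auto
      then have "op_norm (perturb_prod d n X - mat_exp \<mu>) \<le> 2 * exp L"
        by (intro op_norm_le[of d]) auto
      also have "exp L \<le> K"
        using False n by (simp add: K_def field_simps)
      also have "2 * K \<le> R"
        unfolding R using mult_left_mono[OF sl, of "30 * K"] K by simp
      finally show ?case using elim by (simp add: G_def)
    qed
    then have "measure ?P G = 1" using G by (simp add: P.prob_eq_1)
    then show ?thesis using \<delta> by simp
  next
    case True
    \<comment> \<open>The least power of two above \<open>l\<close> overshoots by a factor of at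
      most 2; for \<open>p = 0\<close> this is where \<open>1 / 2 <= l\<close> enters.\<close>
    obtain p :: nat where p: "l \<le> 2 ^ p" "2 ^ p \<le> 2 * l"
    proof -
      obtain q :: nat where q: "l < 2 ^ q" using real_arch_pow[of 2 l] by auto
      define p where "p = (LEAST p. l \<le> 2 ^ p)"
      have p: "l \<le> 2 ^ p" unfolding p_def by (rule LeastI[of _ q]) (use q in simp)
      have "2 ^ p \<le> 2 * l"
      proof (cases p)
        case 0
        then show ?thesis using l by simp
      next
        case (Suc p')
        then have "\<not> l \<le> 2 ^ p'" using not_less_Least[of p' "\<lambda>p. l \<le> 2 ^ p"] by (simp add: p_def)
        then show ?thesis using Suc by simp
      qed
      then show ?thesis using p that by blast
    qed
    \<comment> \<open>The numerator of the ratio is at most \<open>8 * l * K^2\<close>, so 27 makes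
      the ratio at most \<open>8 / 729 <= 1 / 27\<close>; this is at most \<open>exp (- 3)\<close>
      because \<open>exp 1 <= 3\<close>.\<close>
    define \<tau> where "\<tau> = 27 * K * sqrt l"
    have \<tau>: "0 < \<tau>" using K l by (simp add: \<tau>_def)
    have stepK: "real n * step_bound\<^sup>2 = 4 * K\<^sup>2"
    proof -
      have "(sqrt (real n))\<^sup>2 = real n" by simp
      then show ?thesis
        using n by (simp add: step_bound_def K_def power_mult_distrib power_divide) (simp add: power2_eq_square)
    qed
    have ratio: "2 ^ p * real n * step_bound\<^sup>2 / \<tau>\<^sup>2 \<le> exp (- 3)"
    proof -
      have "2 ^ p * real n * step_bound\<^sup>2 = 2 ^ p * (4 * K\<^sup>2)" by (simp add: stepK mult.assoc)
      also have "\<dots> \<le> 2 * l * (4 * K\<^sup>2)" using p by (intro mult_right_mono) auto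
      finally have "2 ^ p * real n * step_bound\<^sup>2 / \<tau>\<^sup>2 \<le> 2 * l * (4 * K\<^sup>2) / \<tau>\<^sup>2"
        by (rule divide_right_mono) simp
      also have "2 * l * (4 * K\<^sup>2) / \<tau>\<^sup>2 = 8 / 729"
        using K l by (simp add: \<tau>_def power_mult_distrib field_simps)
      also have "8 / 729 \<le> (1 / 27 :: real)" by simp
      also have "\<dots> \<le> exp (- 3)"
      proof -
        have "exp (3 :: real) = exp 1 ^ 3" using exp_of_nat_mult[of 3 "1 :: real"] by simp
        also have "\<dots> \<le> 3 ^ 3" using exp_le by (intro power_mono) auto
        finally show ?thesis by (simp add: exp_minus field_simps)
      qed
      finally show ?thesis .
    qed
    define Bad where "Bad = {X \<in> space ?P. \<not> op_norm (doob n X) \<le> \<tau>}"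
    have "measure ?P Bad \<le> 2 * real d * (2 ^ p * real n * step_bound\<^sup>2 / \<tau>\<^sup>2) ^ 2 ^ p"
      unfolding Bad_def by (rule doob_tail[OF \<tau>])
    also have "\<dots> \<le> 2 * real d * exp (- 3) ^ 2 ^ p"
      using ratio by (intro mult_left_mono power_mono) auto
    also have "exp (- 3 :: real) ^ 2 ^ p = exp (2 ^ p * (- 3))"
      using exp_of_nat_mult[of "2 ^ p" "- 3 :: real"] by simp
    \<comment> \<open>The surplus of 3 over 2 makes the inequality strict, as required for a
      probability strictly above \<open>1 - \<delta>\<close>.\<close>
    also have "2 * real d * exp (2 ^ p * (- 3)) < 2 * real d * exp (- 2 * l)"
      using p l d by (intro mult_strict_left_mono) auto
    also have "exp (- 2 * l) = (\<delta> / real d)\<^sup>2"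
    proof -
      have "exp l = real d / \<delta>" unfolding l_def using \<delta> d by (intro exp_ln) auto
      then have "exp (- l) = \<delta> / real d" by (simp add: exp_minus)
      moreover have "exp (- 2 * l) = (exp (- l))\<^sup>2" by (simp flip: exp_double)
      ultimately show ?thesis by simp
    qed
    also have "2 * real d * (\<delta> / real d)\<^sup>2 = 2 * \<delta> * (\<delta> / real d)"
      using d by (simp add: power2_eq_square)
    \<comment> \<open>One factor \<open>\<delta> / d\<close> has cancelled the dimension; the other,
      at most \<open>1 / 2\<close>, cancels the remaining 2.\<close>
    also have "\<dots> \<le> \<delta>"
      using d\<delta> \<delta> d by (simp add: field_simps)
    finally have Bad: "measure ?P Bad < \<delta>" .
    have "space ?P - G \<subseteq> Bad"
    proof
      fix X assume "X \<in> space ?P - G"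
      then have X: "X \<in> space ?P" and big: "\<not> op_norm (perturb_prod d n X - mat_exp \<mu>) \<le> R"
        by (auto simp: G_def)
      have "op_norm (perturb_prod d n X - mat_exp \<mu>) \<le> R" if small: "op_norm (doob n X) \<le> \<tau>"
      proof -
        note Xc = Xc[OF X]
        have doob_c: "doob n X \<in> carrier_mat d d"
          unfolding doob_def by (intro minus_carrier_mat pow_carrier_mat mean_factor_carrier)
        have "mat_bound d (doob n X) \<tau>"
          using small op_norm_le_iff[OF doob_c] \<tau> by simp
        moreover have "mat_bound d (mat_exp \<mu> - mean_factor ^\<^sub>m n) (exp L - (1 + L / real n) ^ n)"
          unfolding mean_factor_def using L n by (intro mat_bound_exp_minus_pow mat_bound_mean) auto
        moreover have "exp L - (1 + L / real n) ^ n \<le> K"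
        proof -
          have "exp L - (1 + L / real n) ^ n \<le> L\<^sup>2 * exp L / real n"
            using exp_minus_one_plus_pow_le[OF n _ True] L by simp
          also have "\<dots> = L / sqrt (real n) * K"
            using n by (simp add: K_def power2_eq_square)
          also have "\<dots> \<le> 1 * K"
            using True K n by (intro mult_right_mono) (auto simp: divide_simps)
          finally show ?thesis by simp
        qed
        ultimately have "mat_bound d (doob n X - (mat_exp \<mu> - mean_factor ^\<^sub>m n)) (\<tau> + K)"
          by (blast intro: mat_bound_minus mat_bound_mono)
        also have "doob n X - (mat_exp \<mu> - mean_factor ^\<^sub>m n) = perturb_prod d n X - mat_exp \<mu>"
        proof -
          have "doob n X = perturb_prod d n X - mean_factor ^\<^sub>m n" by (rule doob_eq) (rule Xc)
          moreover have "perturb_prod d n X \<in> carrier_mat d d" by (rule carrier) (rule Xc)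
          ultimately show ?thesis
            using mean_carrier by (simp only:) (intro minus_minus_minus_mat[of _ d d]; simp)
        qed
        finally have "op_norm (perturb_prod d n X - mat_exp \<mu>) \<le> \<tau> + K"
          using \<tau> K by (intro op_norm_le[of d]) auto
        \<comment> \<open>The bias costs at most \<open>3 * K * sqrt l\<close>, which completes 27
          to 30.\<close>
        also have "\<dots> \<le> R"
          unfolding \<tau>_def R using mult_left_mono[OF sl, of "3 * K"] K by simp
        finally show ?thesis .
      qed
      then show "X \<in> Bad" using big X by (auto simp: Bad_def)
    qed
    then have "measure ?P (space ?P - G) \<le> measure ?P Bad"
    proof (rule P.finite_measure_mono)
      have "doob n \<in> measurable ?P (mat_borel d)" unfolding iid_law_def by (rule measurable_doob) simp
      from measurable_op_norm_le[OF this, of \<tau>] have "space ?P - {X \<in> space ?P. op_norm (doob n X) \<le> \<tau>} \<in> sets ?P"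
        by (rule sets.compl_sets)
      also have "space ?P - {X \<in> space ?P. op_norm (doob n X) \<le> \<tau>} = Bad" by (auto simp: Bad_def)
      finally show "Bad \<in> sets ?P" .
    qed
    then show ?thesis using Bad P.prob_compl[OF G] by simp
  qed
  then show ?thesis by (simp add: G_def R_def l_def)
qed

end

theorem theorem1p3:
  shows "\<exists>c::real. c > 0 \<and> (\<exists>C::real. C > 0 \<and>
    (\<forall>(n::nat) (d::nat) (L::real) (D::complex mat measure) (\<mu>::complex mat).
      n \<ge> 1 \<longrightarrow> d \<ge> 1 \<longrightarrow> L > 0 \<longrightarrow>
      prob_space D \<longrightarrow> sets D = sets (mat_borel d) \<longrightarrow>
      mat_expectation d D = \<mu> \<longrightarrow>
      (AE A in D. op_norm A \<le> L) \<longrightarrow>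
      (\<forall>t::real. 0 \<le> t \<and> t \<le> L * exp L * sqrt (ln (real d) / real n) \<longrightarrow>
         measure (iid_law n D)
           {X \<in> space (iid_law n D). op_norm (perturb_prod d n X - mat_exp \<mu>) \<ge> t}
         \<le> 2 * real d * exp (- (c * real n * t\<^sup>2 / (L\<^sup>2 * exp (2 * L))))) \<and>
      (\<forall>\<delta>::real. 0 < \<delta> \<and> \<delta> < 1 \<and> (d \<ge> 2 \<or> \<delta> \<le> 1 / 2) \<longrightarrow>
         measure (iid_law n D)
           {X \<in> space (iid_law n D). op_norm (perturb_prod d n X - mat_exp \<mu>)
              \<le> C * L * exp L / sqrt (real n) * sqrt (ln (real d / \<delta>))}
         > 1 - \<delta>)))"
proof (rule exI[of _ 1], intro conjI, simp, rule exI[of _ 30], intro conjI allI impI)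
  fix n d :: nat and L t :: real and D :: "complex mat measure" and \<mu> :: "complex mat"
  assume n: "n \<ge> 1" and d: "d \<ge> 1" and L: "L > 0" and prob: "prob_space D"
    and t: "0 \<le> t \<and> t \<le> L * exp L * sqrt (ln (real d) / real n)"
  interpret P: prob_space "iid_law n D" unfolding iid_law_def by (intro prob_space_PiM prob)
  have "t\<^sup>2 \<le> (L * exp L * sqrt (ln (real d) / real n))\<^sup>2" using t by (intro power_mono) auto
  \<comment> \<open>Squaring the root needs \<open>ln d >= 0\<close>; for \<open>d = 1\<close> the
    admissible range is just \<open>t = 0\<close>.\<close>
  also have "\<dots> = L\<^sup>2 * exp (2 * L) * (ln (real d) / real n)"
    using d n by (simp add: power_mult_distrib exp_double)
  finally have "1 * real n * t\<^sup>2 / (L\<^sup>2 * exp (2 * L)) \<le> ln (real d)"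
    using n L by (simp add: field_simps)
  then have "2 * real d * exp (- ln (real d))
      \<le> 2 * real d * exp (- (1 * real n * t\<^sup>2 / (L\<^sup>2 * exp (2 * L))))"
    by (intro mult_left_mono) auto
  moreover have "2 * real d * exp (- ln (real d)) = 2" using d by (simp add: exp_minus)
  moreover have "measure (iid_law n D)
      {X \<in> space (iid_law n D). op_norm (perturb_prod d n X - mat_exp \<mu>) \<ge> t} \<le> 1"
    by (rule P.prob_le_1)
  ultimately show "measure (iid_law n D)
      {X \<in> space (iid_law n D). op_norm (perturb_prod d n X - mat_exp \<mu>) \<ge> t}
      \<le> 2 * real d * exp (- (1 * real n * t\<^sup>2 / (L\<^sup>2 * exp (2 * L))))" by linarith
qed (use deviation_high_prob in auto)

end
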